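(* Let $R$ be a normed ring, let $n\ge1$, let $X$ be an $n$-connected Kan complex, and let $\mathcal{A}$ be a seminormed local coefficient system on $X$. Then: (i) $H_b^i(X;\mathcal{A})=0$ for all $i\in\{1,\ldots,n\}$; (ii) the cochain complex $C_b^\bullet(X;\mathcal{A})$ satisfies the uniform boundary condition in degree $i$ for all $i\le n$.
   Context: Fix a normed ring $(R,|\cdot|)$. $\mathrm{Mod}^{\mathrm{sn}}_R$ is the category of seminormed $R$-modules ($\|ra_1+a_2\|\le|r|\|a_1\|+\|a_2\|$) and seminorm non-increasing $R$-linear maps. For a simplicial set $X$, the fundamental groupoid $\pi(X)$ has object set $X_0$ and is generated as a groupoid by $X_1$ (an edge $\sigma$ is a morphism $\partial_1\sigma\to\partial_0\sigma$) with relations $\partial_0\sigma\circ\partial_2\sigma=\partial_1\sigma$ for $\sigma\in X_2$. A seminormed local coefficient system on $X$ is a functor $\mathcal{A}\colon\pi(X)\to\mathrm{Mod}_R^{\mathrm{sn}}$. $C_b^n(X;\mathcal{A})$ is the seminormed module of functions $\varphi$ on $X_n$ with $\varphi(\sigma)\in\mathcal{A}(\sigma_0)$ ($\sigma_0$ the $0$-th vertex of $\sigma$) and $\|\varphi\|_\infty=\sup_\sigma\|\varphi(\sigma)\|_{\mathcal{A}(\sigma_0)}<\infty$, with differential $\delta^n(\varphi)(\sigma)=\mathcal{A}([\sigma_{[0,1]}]^{-1})(\varphi(\partial_0\sigma))+\sum_{i=1}^{n+1}(-1)^i\varphi(\partial_i\sigma)$, where $\sigma_{[0,1]}$ is the front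 edge of $\sigma$. $H_b^*(X;\mathcal{A})$ is its cohomology. A (non-empty) Kan complex is $n$-connected if its (simplicial) homotopy groups/sets are trivial in all degrees $\le n$. A cochain complex $(C^\bullet,\delta^\bullet)$ of seminormed $R$-modules satisfies the uniform boundary condition in degree $i$ if there is $\kappa\in\mathbb{R}_{\ge0}$ such that every $b\in\operatorname{im}(\delta^{i-1}\colon C^{i-1}\to C^i)$ has the form $b=\delta^{i-1}(c)$ with $\|c\|\le\kappa\|b\|$. *)

theory Defs
  imports Complex_Main "HOL-Algebra.Elementary_Groups" "HOL-Algebra.AbelCoset" "HOL-Algebra.Module"
begin

section \<open>Normed rings and seminormed modules\<close>

record 'r normed_ring = "'r ring" +
  rnorm :: "'r \<Rightarrow> real"

text \<open>Rings are unital but need not be commutative, and the norm of the unit is not prescribed.\<close>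

locale normed_ring = ring R for R :: "'r normed_ring" (structure) +
  assumes rnorm_nonneg: "r \<in> carrier R \<Longrightarrow> 0 \<le> rnorm R r"
    and rnorm_eq_zero_iff: "r \<in> carrier R \<Longrightarrow> rnorm R r = 0 \<longleftrightarrow> r = \<zero>"
    and rnorm_minus: "r \<in> carrier R \<Longrightarrow> rnorm R (\<ominus> r) = rnorm R r"
    and rnorm_add: "\<lbrakk>r \<in> carrier R; s \<in> carrier R\<rbrakk> \<Longrightarrow> rnorm R (r \<oplus> s) \<le> rnorm R r + rnorm R s"
    and rnorm_mult: "\<lbrakk>r \<in> carrier R; s \<in> carrier R\<rbrakk> \<Longrightarrow> rnorm R (r \<otimes> s) \<le> rnorm R r * rnorm R s"

text \<open>
  The locale \<open>module\<close> of the library requires a commutative ring of scalars. The following is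
  the same list of axioms over an arbitrary ring.
\<close>

locale left_module = R?: ring R + M?: abelian_group M
  for R :: "('r, 'p) ring_scheme" (structure) and M :: "('r, 'm, 'q) module_scheme" (structure) +
  assumes smult_closed: "\<lbrakk>r \<in> carrier R; a \<in> carrier M\<rbrakk> \<Longrightarrow> r \<odot>\<^bsub>M\<^esub> a \<in> carrier M"
    and smult_l_distr: "\<lbrakk>r \<in> carrier R; s \<in> carrier R; a \<in> carrier M\<rbrakk> \<Longrightarrow>
      (r \<oplus>\<^bsub>R\<^esub> s) \<odot>\<^bsub>M\<^esub> a = r \<odot>\<^bsub>M\<^esub> a \<oplus>\<^bsub>M\<^esub> s \<odot>\<^bsub>M\<^esub> a"
    and smult_r_distr: "\<lbrakk>r \<in> carrier R; a \<in> carrier M; b \<in> carrier M\<rbrakk> \<Longrightarrow>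
      r \<odot>\<^bsub>M\<^esub> (a \<oplus>\<^bsub>M\<^esub> b) = r \<odot>\<^bsub>M\<^esub> a \<oplus>\<^bsub>M\<^esub> r \<odot>\<^bsub>M\<^esub> b"
    and smult_assoc: "\<lbrakk>r \<in> carrier R; s \<in> carrier R; a \<in> carrier M\<rbrakk> \<Longrightarrow>
      (r \<otimes>\<^bsub>R\<^esub> s) \<odot>\<^bsub>M\<^esub> a = r \<odot>\<^bsub>M\<^esub> (s \<odot>\<^bsub>M\<^esub> a)"
    and smult_one: "a \<in> carrier M \<Longrightarrow> \<one>\<^bsub>R\<^esub> \<odot>\<^bsub>M\<^esub> a = a"

lemma left_module_iff_module: "cring R \<Longrightarrow> left_module R M \<longleftrightarrow> module R M"
  by (auto simp: left_module_def left_module_axioms_def module_def module_axioms_def cring.axioms(1))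

record ('r, 'm) seminormed_module = "('r, 'm) module" +
  seminorm :: "'m \<Rightarrow> real"

locale seminormed_module = left_module R M
  for R :: "'r normed_ring" (structure) and M :: "('r, 'm) seminormed_module" (structure) +
  assumes seminorm_nonneg: "a \<in> carrier M \<Longrightarrow> 0 \<le> seminorm M a"
    and seminorm_zero: "seminorm M \<zero>\<^bsub>M\<^esub> = 0"
    and seminorm_smult_add: "\<lbrakk>r \<in> carrier R; a \<in> carrier M; b \<in> carrier M\<rbrakk> \<Longrightarrow>
      seminorm M (r \<odot>\<^bsub>M\<^esub> a \<oplus>\<^bsub>M\<^esub> b) \<le> rnorm R r * seminorm M a + seminorm M b"

definition seminormed_hom ::
    "'r normed_ring \<Rightarrow> ('r, 'm) seminormed_module \<Rightarrow> ('r, 'n) seminormed_module \<Rightarrow> ('m \<Rightarrow> 'n) set" where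
  "seminormed_hom R M N = {f \<in> carrier M \<rightarrow> carrier N.
     (\<forall>a\<in>carrier M. \<forall>b\<in>carrier M. f (a \<oplus>\<^bsub>M\<^esub> b) = f a \<oplus>\<^bsub>N\<^esub> f b) \<and>
     (\<forall>r\<in>carrier R. \<forall>a\<in>carrier M. f (r \<odot>\<^bsub>M\<^esub> a) = r \<odot>\<^bsub>N\<^esub> f a) \<and>
     (\<forall>a\<in>carrier M. seminorm N (f a) \<le> seminorm M a)}"

text \<open>The bounded sections of a family of seminormed modules, with the supremum seminorm. The
  ring multiplication slots of the record carry no meaning for a module. Inserting \<open>0\<close> gives
  the supremum the intended value if the index set is empty.\<close>

definition bounded_sections ::
    "'i set \<Rightarrow> ('i \<Rightarrow> ('r, 'm) seminormed_module) \<Rightarrow> ('r, 'i \<Rightarrow> 'm) seminormed_module" where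
  "bounded_sections I M =
    \<lparr>carrier = {\<phi> \<in> (\<Pi>\<^sub>E i\<in>I. carrier (M i)). bdd_above ((\<lambda>i. seminorm (M i) (\<phi> i)) ` I)},
     mult = undefined, one = undefined,
     zero = (\<lambda>i\<in>I. \<zero>\<^bsub>M i\<^esub>),
     add = (\<lambda>\<phi> \<psi>. \<lambda>i\<in>I. \<phi> i \<oplus>\<^bsub>M i\<^esub> \<psi> i),
     smult = (\<lambda>r \<phi>. \<lambda>i\<in>I. r \<odot>\<^bsub>M i\<^esub> \<phi> i),
     seminorm = (\<lambda>\<phi>. Sup (insert 0 ((\<lambda>i. seminorm (M i) (\<phi> i)) ` I)))\<rparr>"


section \<open>Cochain complexes of seminormed modules\<close>

text \<open>Complexes are graded by the integers; \<open>Diff C i\<close> goes from degree \<open>i\<close> to degree \<open>i + 1\<close>.\<close>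

record ('r, 'c) seminormed_complex =
  Term :: "int \<Rightarrow> ('r, 'c) seminormed_module"
  Diff :: "int \<Rightarrow> 'c \<Rightarrow> 'c"

definition cocycles :: "('r, 'c) seminormed_complex \<Rightarrow> int \<Rightarrow> 'c set" where
  "cocycles C i = a_kernel (Term C i) (Term C (i + 1)) (Diff C i)"

definition coboundaries :: "('r, 'c) seminormed_complex \<Rightarrow> int \<Rightarrow> 'c set" where
  "coboundaries C i = Diff C (i - 1) ` carrier (Term C (i - 1))"

text \<open>Only the additive group underlying the cohomology module is recorded.\<close>

definition cohomology :: "('r, 'c) seminormed_complex \<Rightarrow> int \<Rightarrow> 'c set monoid" where
  "cohomology C i = (Term C i)\<lparr>carrier := cocycles C i\<rparr> A_Mod coboundaries C i"

definition uniform_boundary_condition :: "('r, 'c) seminormed_complex \<Rightarrow> int \<Rightarrow> bool" where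
  "uniform_boundary_condition C i \<longleftrightarrow>
     (\<exists>\<kappa>\<ge>0. \<forall>b\<in>coboundaries C i. \<exists>c\<in>carrier (Term C (i - 1)).
        Diff C (i - 1) c = b \<and> seminorm (Term C (i - 1)) c \<le> \<kappa> * seminorm (Term C i) b)"


section \<open>Simplicial sets, Kan complexes and simplicial homotopy groups\<close>

text \<open>\<open>Face X n i\<close> and \<open>Degen X n i\<close> are the \<open>i\<close>-th face and degeneracy operators defined on the
  \<open>n\<close>-simplices.\<close>

record 'x sset =
  Simp :: "nat \<Rightarrow> 'x set"
  Face :: "nat \<Rightarrow> nat \<Rightarrow> 'x \<Rightarrow> 'x"
  Degen :: "nat \<Rightarrow> nat \<Rightarrow> 'x \<Rightarrow> 'x"

locale simplicial_set =
  fixes X :: "'x sset"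
  assumes Face_closed: "\<lbrakk>\<sigma> \<in> Simp X (Suc n); i \<le> Suc n\<rbrakk> \<Longrightarrow> Face X (Suc n) i \<sigma> \<in> Simp X n"
    and Degen_closed: "\<lbrakk>\<sigma> \<in> Simp X n; i \<le> n\<rbrakk> \<Longrightarrow> Degen X n i \<sigma> \<in> Simp X (Suc n)"
    and Face_Face: "\<lbrakk>\<sigma> \<in> Simp X (Suc (Suc n)); i < j; j \<le> Suc (Suc n)\<rbrakk> \<Longrightarrow>
      Face X (Suc n) i (Face X (Suc (Suc n)) j \<sigma>) = Face X (Suc n) (j - 1) (Face X (Suc (Suc n)) i \<sigma>)"
    and Face_Degen_less: "\<lbrakk>\<sigma> \<in> Simp X (Suc n); i < j; j \<le> Suc n\<rbrakk> \<Longrightarrow>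
      Face X (Suc (Suc n)) i (Degen X (Suc n) j \<sigma>) = Degen X n (j - 1) (Face X (Suc n) i \<sigma>)"
    and Face_Degen_eq: "\<lbrakk>\<sigma> \<in> Simp X n; j \<le> n\<rbrakk> \<Longrightarrow> Face X (Suc n) j (Degen X n j \<sigma>) = \<sigma>"
    and Face_Degen_Suc: "\<lbrakk>\<sigma> \<in> Simp X n; j \<le> n\<rbrakk> \<Longrightarrow> Face X (Suc n) (Suc j) (Degen X n j \<sigma>) = \<sigma>"
    and Face_Degen_greater: "\<lbrakk>\<sigma> \<in> Simp X (Suc n); Suc j < i; i \<le> Suc (Suc n)\<rbrakk> \<Longrightarrow>
      Face X (Suc (Suc n)) i (Degen X (Suc n) j \<sigma>) = Degen X n j (Face X (Suc n) (i - 1) \<sigma>)"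
    and Degen_Degen: "\<lbrakk>\<sigma> \<in> Simp X n; i \<le> j; j \<le> n\<rbrakk> \<Longrightarrow>
      Degen X (Suc n) i (Degen X n j \<sigma>) = Degen X (Suc n) (Suc j) (Degen X n i \<sigma>)"

text \<open>Horns \<open>\<Lambda>\<^sup>n\<^sup>+\<^sup>1\<^sub>k \<rightarrow> X\<close> are given by their faces \<open>y i\<close>, \<open>i \<noteq> k\<close>. For \<open>n = 0\<close> there is a single
  face and no compatibility condition.\<close>

definition horn :: "'x sset \<Rightarrow> nat \<Rightarrow> nat \<Rightarrow> (nat \<Rightarrow> 'x) \<Rightarrow> bool" where
  "horn X n k y \<longleftrightarrow> (\<forall>i. i \<le> Suc n \<and> i \<noteq> k \<longrightarrow> y i \<in> Simp X n) \<and>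
     (\<forall>i j. i < j \<and> j \<le> Suc n \<and> i \<noteq> k \<and> j \<noteq> k \<longrightarrow> Face X n i (y j) = Face X n (j - 1) (y i))"

locale Kan_complex = simplicial_set X for X :: "'x sset" +
  assumes horn_filler: "\<lbrakk>k \<le> Suc n; horn X n k y\<rbrakk> \<Longrightarrow>
    \<exists>\<tau>\<in>Simp X (Suc n). \<forall>i. i \<le> Suc n \<and> i \<noteq> k \<longrightarrow> Face X (Suc n) i \<tau> = y i"

primrec const_simplex :: "'x sset \<Rightarrow> nat \<Rightarrow> 'x \<Rightarrow> 'x" where
  "const_simplex X 0 x = x"
| "const_simplex X (Suc m) x = Degen X m 0 (const_simplex X m x)"

text \<open>The simplicial homotopy sets of a Kan complex: \<open>m\<close>-simplices with boundary at the base point,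
  modulo simplicial homotopy relative to the boundary. For \<open>m = 0\<close> these are the vertices modulo
  the relation of being joined by an edge.\<close>

definition spheroids :: "'x sset \<Rightarrow> nat \<Rightarrow> 'x \<Rightarrow> 'x set" where
  "spheroids X m x =
    {\<sigma> \<in> Simp X m. 0 < m \<longrightarrow> (\<forall>i\<le>m. Face X m i \<sigma> = const_simplex X (m - 1) x)}"

definition spheroid_homotopy :: "'x sset \<Rightarrow> nat \<Rightarrow> 'x \<Rightarrow> 'x rel" where
  "spheroid_homotopy X m x = {(\<sigma>, \<tau>). \<sigma> \<in> spheroids X m x \<and> \<tau> \<in> spheroids X m x \<and>
     (\<exists>\<omega>\<in>Simp X (Suc m). (\<forall>i<m. Face X (Suc m) i \<omega> = const_simplex X m x) \<and>
        Face X (Suc m) m \<omega> = \<sigma> \<and> Face X (Suc m) (Suc m) \<omega> = \<tau>)}"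

definition homotopy_set :: "'x sset \<Rightarrow> nat \<Rightarrow> 'x \<Rightarrow> 'x set set" where
  "homotopy_set X m x = spheroids X m x // spheroid_homotopy X m x"

definition n_connected :: "nat \<Rightarrow> 'x sset \<Rightarrow> bool" where
  "n_connected n X \<longleftrightarrow> Simp X 0 \<noteq> {} \<and> (\<forall>m\<le>n. \<forall>x\<in>Simp X 0. is_singleton (homotopy_set X m x))"

text \<open>\<open>front_face X k m \<sigma>\<close> is the front \<open>k\<close>-face of a \<open>(k + m)\<close>-simplex.\<close>

primrec front_face :: "'x sset \<Rightarrow> nat \<Rightarrow> nat \<Rightarrow> 'x \<Rightarrow> 'x" where
  "front_face X k 0 \<sigma> = \<sigma>"
| "front_face X k (Suc m) \<sigma> = front_face X k m (Face X (k + Suc m) (k + Suc m) \<sigma>)"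

abbreviation first_vertex :: "'x sset \<Rightarrow> nat \<Rightarrow> 'x \<Rightarrow> 'x" where
  "first_vertex X n \<equiv> front_face X 0 n"

abbreviation front_edge :: "'x sset \<Rightarrow> nat \<Rightarrow> 'x \<Rightarrow> 'x" where
  "front_edge X n \<equiv> front_face X 1 (n - 1)"


section \<open>The fundamental groupoid\<close>

text \<open>\<open>Comp G g f\<close> means \<open>f\<close> followed by \<open>g\<close>.\<close>

record ('o, 'a) groupoid =
  Obj :: "'o set"
  Hom :: "'o \<Rightarrow> 'o \<Rightarrow> 'a set"
  Id :: "'o \<Rightarrow> 'a"
  Comp :: "'a \<Rightarrow> 'a \<Rightarrow> 'a"
  Inv :: "'a \<Rightarrow> 'a"

locale groupoid =
  fixes G :: "('o, 'a) groupoid"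
  assumes Id_closed: "x \<in> Obj G \<Longrightarrow> Id G x \<in> Hom G x x"
    and Comp_closed: "\<lbrakk>x \<in> Obj G; y \<in> Obj G; z \<in> Obj G; f \<in> Hom G x y; g \<in> Hom G y z\<rbrakk> \<Longrightarrow>
      Comp G g f \<in> Hom G x z"
    and Inv_closed: "\<lbrakk>x \<in> Obj G; y \<in> Obj G; f \<in> Hom G x y\<rbrakk> \<Longrightarrow> Inv G f \<in> Hom G y x"
    and Comp_assoc: "\<lbrakk>x \<in> Obj G; y \<in> Obj G; z \<in> Obj G; w \<in> Obj G;
      f \<in> Hom G x y; g \<in> Hom G y z; h \<in> Hom G z w\<rbrakk> \<Longrightarrow> Comp G h (Comp G g f) = Comp G (Comp G h g) f"
    and Comp_Id: "\<lbrakk>x \<in> Obj G; y \<in> Obj G; f \<in> Hom G x y\<rbrakk> \<Longrightarrow> Comp G f (Id G x) = f"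
    and Id_Comp: "\<lbrakk>x \<in> Obj G; y \<in> Obj G; f \<in> Hom G x y\<rbrakk> \<Longrightarrow> Comp G (Id G y) f = f"
    and Inv_Comp: "\<lbrakk>x \<in> Obj G; y \<in> Obj G; f \<in> Hom G x y\<rbrakk> \<Longrightarrow> Comp G (Inv G f) f = Id G x"
    and Comp_Inv: "\<lbrakk>x \<in> Obj G; y \<in> Obj G; f \<in> Hom G x y\<rbrakk> \<Longrightarrow> Comp G f (Inv G f) = Id G y"

text \<open>The morphisms are classes of zigzags of edges: words in the edges and their formal inverses,
  read in the order in which they are traversed, together with their two end points.\<close>

datatype 'x letter = Fwd (edge: 'x) | Bwd (edge: 'x)

type_synonym 'x zigzag = "'x \<times> 'x letter list \<times> 'x"

fun flip :: "'x letter \<Rightarrow> 'x letter" where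
  "flip (Fwd e) = Bwd e"
| "flip (Bwd e) = Fwd e"

fun source :: "'x sset \<Rightarrow> 'x letter \<Rightarrow> 'x" where
  "source X (Fwd e) = Face X 1 1 e"
| "source X (Bwd e) = Face X 1 0 e"

fun target :: "'x sset \<Rightarrow> 'x letter \<Rightarrow> 'x" where
  "target X (Fwd e) = Face X 1 0 e"
| "target X (Bwd e) = Face X 1 1 e"

fun path :: "'x sset \<Rightarrow> 'x \<Rightarrow> 'x letter list \<Rightarrow> 'x \<Rightarrow> bool" where
  "path X x [] y \<longleftrightarrow> x \<in> Simp X 0 \<and> x = y"
| "path X x (l # w) y \<longleftrightarrow> edge l \<in> Simp X 1 \<and> source X l = x \<and> path X (target X l) w y"

definition zigzags :: "'x sset \<Rightarrow> 'x \<Rightarrow> 'x \<Rightarrow> 'x zigzag set" where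
  "zigzags X x y = {(x, w, y) | w. path X x w y}"

inductive_set zigzag_rel :: "'x sset \<Rightarrow> 'x zigzag rel" for X :: "'x sset" where
  zigzag_refl: "path X x w y \<Longrightarrow> ((x, w, y), (x, w, y)) \<in> zigzag_rel X"
| zigzag_sym: "(p, q) \<in> zigzag_rel X \<Longrightarrow> (q, p) \<in> zigzag_rel X"
| zigzag_trans: "\<lbrakk>(p, q) \<in> zigzag_rel X; (q, r) \<in> zigzag_rel X\<rbrakk> \<Longrightarrow> (p, r) \<in> zigzag_rel X"
| zigzag_cancel: "path X x (u @ [l, flip l] @ v) y \<Longrightarrow>
    ((x, u @ [l, flip l] @ v, y), (x, u @ v, y)) \<in> zigzag_rel X"
| zigzag_triangle: "\<lbrakk>\<sigma> \<in> Simp X 2; path X x (u @ [Fwd (Face X 2 2 \<sigma>), Fwd (Face X 2 0 \<sigma>)] @ v) y\<rbrakk> \<Longrightarrow>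
    ((x, u @ [Fwd (Face X 2 2 \<sigma>), Fwd (Face X 2 0 \<sigma>)] @ v, y),
     (x, u @ [Fwd (Face X 2 1 \<sigma>)] @ v, y)) \<in> zigzag_rel X"

definition fundamental_groupoid :: "'x sset \<Rightarrow> ('x, 'x zigzag set) groupoid" where
  "fundamental_groupoid X =
    \<lparr>Obj = Simp X 0,
     Hom = (\<lambda>x y. zigzags X x y // zigzag_rel X),
     Id = (\<lambda>x. zigzag_rel X `` {(x, [], x)}),
     Comp = (\<lambda>g f. zigzag_rel X `` {(x, u @ v, z) | x u y v z. (x, u, y) \<in> f \<and> (y, v, z) \<in> g}),
     Inv = (\<lambda>f. zigzag_rel X `` {(y, rev (map flip w), x) | x w y. (x, w, y) \<in> f})\<rparr>"

definition edge_class :: "'x sset \<Rightarrow> 'x \<Rightarrow> 'x zigzag set" where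
  "edge_class X e = zigzag_rel X `` {(Face X 1 1 e, [Fwd e], Face X 1 0 e)}"

lemma source_flip [simp]: "source X (flip l) = target X l" "target X (flip l) = source X l"
  "edge (flip l) = edge l" "flip (flip l) = l"
  by (cases l; simp)+

context simplicial_set
begin

lemma source_target_closed:
  assumes "edge l \<in> Simp X 1"
  shows "source X l \<in> Simp X 0" "target X l \<in> Simp X 0"
  using assms Face_closed[of "edge l" 0 0] Face_closed[of "edge l" 0 1] by (cases l; simp)+

lemma path_ends: "path X x w y \<Longrightarrow> x \<in> Simp X 0 \<and> y \<in> Simp X 0"
  by (induction w arbitrary: x) (auto simp: source_target_closed)

lemma path_append: "path X x (u @ v) z \<longleftrightarrow> (\<exists>y. path X x u y \<and> path X y v z)"
  by (induction u arbitrary: x) (auto dest: path_ends)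

lemma path_rev: "path X x w y \<Longrightarrow> path X y (rev (map flip w)) x"
  by (induction w arbitrary: x) (auto simp: path_append source_target_closed)

lemma triangle_faces:
  assumes "\<sigma> \<in> Simp X 2"
  shows "Face X 2 i \<sigma> \<in> Simp X 1 \<or> 2 < i"
    "Face X 1 0 (Face X 2 0 \<sigma>) = Face X 1 0 (Face X 2 1 \<sigma>)"
    "Face X 1 1 (Face X 2 1 \<sigma>) = Face X 1 1 (Face X 2 2 \<sigma>)"
    "Face X 1 1 (Face X 2 0 \<sigma>) = Face X 1 0 (Face X 2 2 \<sigma>)"
  using assms Face_closed[of \<sigma> 1 i] Face_Face[of \<sigma> 0 0 1] Face_Face[of \<sigma> 0 1 2] Face_Face[of \<sigma> 0 0 2]
  by (auto simp: numeral_2_eq_2)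

lemma zigzag_rel_path:
  assumes "(p, q) \<in> zigzag_rel X"
  shows "\<exists>x w w' y. p = (x, w, y) \<and> q = (x, w', y) \<and> path X x w y \<and> path X x w' y"
  using assms
proof induction
  case (zigzag_cancel x u l v y)
  then show ?case by (auto simp: path_append source_target_closed)
next
  case (zigzag_triangle \<sigma> x u v y)
  have "Face X 2 1 \<sigma> \<in> Simp X 1" using triangle_faces(1)[OF zigzag_triangle(1), of 1] by auto
  with zigzag_triangle show ?case using triangle_faces(2-)[OF zigzag_triangle(1)] by (auto simp: path_append)
qed auto

lemma zigzag_rel_context:
  assumes "(p, q) \<in> zigzag_rel X" "p = (x, w, y)" "q = (x, w', y)" "path X a s x" "path X y t b"
  shows "((a, s @ w @ t, b), (a, s @ w' @ t, b)) \<in> zigzag_rel X"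
  using assms
proof (induction arbitrary: x w w' y)
  case (zigzag_refl x0 w0 y0)
  then have "path X a (s @ w @ t) b" "w' = w" using path_append by auto
  then show ?case by (auto intro: zigzag_rel.zigzag_refl)
next
  case (zigzag_sym p q)
  show ?case
    by (rule zigzag_rel.zigzag_sym, rule zigzag_sym.IH) (use zigzag_sym.prems in auto)
next
  case (zigzag_trans p q r)
  from zigzag_rel_path[OF zigzag_trans.hyps(1)] zigzag_trans.prems(1)
  obtain w'' where q: "q = (x, w'', y)" by blast
  note pr = zigzag_trans.prems
  show ?case
    by (rule zigzag_rel.zigzag_trans[OF zigzag_trans.IH(1)[OF pr(1) q pr(3,4)]
          zigzag_trans.IH(2)[OF q pr(2-4)]])
next
  case (zigzag_cancel x' u l v y')
  from zigzag_cancel.prems(1,2) have eqs: "x' = x" "y' = y" "w = u @ [l, flip l] @ v" "w' = u @ v"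
    by auto
  have "path X a (s @ w @ t) b"
    using zigzag_cancel.hyps zigzag_cancel.prems(3,4) unfolding eqs(1,2) eqs(3)[symmetric] by (metis path_append)
  with zigzag_rel.zigzag_cancel[of X a "s @ u" l "v @ t" b] show ?case by (simp add: eqs)
next
  case (zigzag_triangle \<sigma> x' u v y')
  let ?k = "[Fwd (Face X 2 2 \<sigma>), Fwd (Face X 2 0 \<sigma>)]"
  from zigzag_triangle.prems(1,2) have eqs: "x' = x" "y' = y" "w = u @ ?k @ v"
      "w' = u @ [Fwd (Face X 2 1 \<sigma>)] @ v"
    by auto
  have "path X a (s @ w @ t) b"
    using zigzag_triangle.hyps(2) zigzag_triangle.prems(3,4) unfolding eqs(1,2) eqs(3)[symmetric] by (metis path_append)
  with zigzag_rel.zigzag_triangle[OF zigzag_triangle.hyps(1), of a "s @ u" "v @ t" b] show ?case by (simp add: eqs)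
qed

lemma zigzag_rel_append:
  assumes "((x, u, y), (x, u', y)) \<in> zigzag_rel X" "((y, v, z), (y, v', z)) \<in> zigzag_rel X"
  shows "((x, u @ v, z), (x, u' @ v', z)) \<in> zigzag_rel X"
proof -
  have p: "path X x u y" "path X x u' y" "path X y v z" "path X y v' z"
    using zigzag_rel_path[OF assms(1)] zigzag_rel_path[OF assms(2)] by auto
  have "path X x [] x" "path X z [] z" using p path_ends by auto
  then show ?thesis
    using zigzag_rel_context[OF assms(1) refl refl _ p(3), of x "[]"]
      zigzag_rel_context[OF assms(2) refl refl p(2), of "[]" z]
    by (auto intro: zigzag_rel.zigzag_trans)
qed

lemma zigzag_rel_cancel:
  "path X x w y \<Longrightarrow> ((x, w @ rev (map flip w), x), (x, [], x)) \<in> zigzag_rel X"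
proof (induction w arbitrary: x)
  case Nil then show ?case by (auto intro: zigzag_rel.zigzag_refl)
next
  case (Cons l w)
  let ?z = "target X l"
  have e: "path X x [l] ?z" "path X ?z [flip l] x" "path X ?z w y" 
    using Cons.prems by (auto simp: source_target_closed)
  from zigzag_rel_context[OF Cons.IH[OF e(3)] refl refl e(1,2)]
  have "((x, (l # w) @ rev (map flip (l # w)), x), (x, [l, flip l], x)) \<in> zigzag_rel X" by simp
  moreover have "((x, [] @ [l, flip l] @ [], x), (x, [] @ [], x)) \<in> zigzag_rel X"
    using e by (intro zigzag_rel.zigzag_cancel) auto
  ultimately show ?case by (auto intro: zigzag_rel.zigzag_trans)
qed

lemma zigzag_rel_rev:
  assumes "((x, w, y), (x, w', y)) \<in> zigzag_rel X"
  shows "((y, rev (map flip w), x), (y, rev (map flip w'), x)) \<in> zigzag_rel X"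
proof -
  let ?r = "\<lambda>w. rev (map flip w)"
  have p: "path X x w y" "path X x w' y" using zigzag_rel_path[OF assms] by auto
  have r: "path X y (?r w) x" "path X y (?r w') x" using p path_rev by auto
  have n: "path X x [] x" "path X y [] y" using p path_ends by auto
  have 1: "((y, ?r w @ w, y), (y, [], y)) \<in> zigzag_rel X"
    using zigzag_rel_cancel[OF r(1)] by (simp add: rev_map o_def)
  have 2: "((x, w' @ ?r w', x), (x, [], x)) \<in> zigzag_rel X" by (rule zigzag_rel_cancel[OF p(2)])
  have "((y, ?r w @ w' @ ?r w', x), (y, ?r w, x)) \<in> zigzag_rel X"
    using zigzag_rel_context[OF 2 refl refl r(1) n(1)] by simp
  moreover have "((y, ?r w @ w @ ?r w', x), (y, ?r w @ w' @ ?r w', x)) \<in> zigzag_rel X"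
    using zigzag_rel_context[OF assms refl refl r(1) r(2)] by simp
  moreover have "((y, ?r w @ w @ ?r w', x), (y, ?r w', x)) \<in> zigzag_rel X"
    using zigzag_rel_context[OF 1 refl refl n(2) r(2)] by simp
  ultimately show ?thesis by (blast intro: zigzag_rel.zigzag_trans zigzag_rel.zigzag_sym)
qed

abbreviation zigzag_class where "zigzag_class x w y \<equiv> zigzag_rel X `` {(x, w, y)}"

lemma cls_eq:
  assumes "((x, w, y), (x, w', y)) \<in> zigzag_rel X"
  shows "zigzag_class x w y = zigzag_class x w' y"
  using zigzag_rel.zigzag_trans[OF assms] zigzag_rel.zigzag_trans[OF zigzag_rel.zigzag_sym[OF assms]]
  by fast

lemma in_cls:
  "(a, w', b) \<in> zigzag_class x w y \<longleftrightarrow> a = x \<and> b = y \<and> ((x, w, y), (x, w', y)) \<in> zigzag_rel X"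
  using zigzag_rel_path[of "(x, w, y)" "(a, w', b)" for a b] by auto

lemma Hom_cls: "f \<in> Hom (fundamental_groupoid X) x y \<longleftrightarrow> (\<exists>w. path X x w y \<and> f = zigzag_class x w y)"
  by (auto simp: fundamental_groupoid_def zigzags_def quotient_def)

lemma Comp_cls:
  assumes "path X x u y" "path X y v z"
  shows "Comp (fundamental_groupoid X) (zigzag_class y v z) (zigzag_class x u y) = zigzag_class x (u @ v) z"
proof -
  have "zigzag_rel X `` {(x', u' @ v', z') |x' u' y' v' z'. (x', u', y') \<in> zigzag_class x u y \<and> (y', v', z') \<in> zigzag_class y v z}
    = zigzag_class x (u @ v) z" (is "?L = ?R")
  proof (rule equalityI; rule subsetI)
    fix p assume "p \<in> ?L"
    then obtain u' v' where "((x, u, y), (x, u', y)) \<in> zigzag_rel X" "((y, v, z), (y, v', z)) \<in> zigzag_rel X"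
      and p: "((x, u' @ v', z), p) \<in> zigzag_rel X"
      unfolding in_cls by blast
    then show "p \<in> ?R" using zigzag_rel.zigzag_trans[OF zigzag_rel_append p] by simp
  next
    fix p assume p: "p \<in> ?R"
    have "(x, u, y) \<in> zigzag_class x u y" "(y, v, z) \<in> zigzag_class y v z" using assms by (auto intro: zigzag_rel.zigzag_refl)
    with p show "p \<in> ?L" by blast
  qed
  then show ?thesis by (simp add: fundamental_groupoid_def)
qed

lemma Inv_cls:
  assumes "path X x w y"
  shows "Inv (fundamental_groupoid X) (zigzag_class x w y) = zigzag_class y (rev (map flip w)) x"
proof -
  have "zigzag_rel X `` {(y', rev (map flip w'), x') | x' w' y'. (x', w', y') \<in> zigzag_class x w y} = zigzag_class y (rev (map flip w)) x"
    (is "?L = ?R")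
  proof (rule equalityI; rule subsetI)
    fix p assume "p \<in> ?L"
    then obtain w' where "((x, w, y), (x, w', y)) \<in> zigzag_rel X"
      and p: "((y, rev (map flip w'), x), p) \<in> zigzag_rel X"
      unfolding in_cls by blast
    then show "p \<in> ?R" using zigzag_rel.zigzag_trans[OF zigzag_rel_rev p] by simp
  next
    fix p assume p: "p \<in> ?R"
    have "(x, w, y) \<in> zigzag_class x w y" using assms by (auto intro: zigzag_rel.zigzag_refl)
    with p show "p \<in> ?L" by blast
  qed
  then show ?thesis by (simp add: fundamental_groupoid_def)
qed

lemma groupoid_fundamental_groupoid: "groupoid (fundamental_groupoid X)" (is "groupoid ?G")
proof -
  have Ob [simp]: "Obj ?G = Simp X 0" and Id [simp]: "Id ?G x = zigzag_class x [] x" for x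
    by (simp_all add: fundamental_groupoid_def)
  have nil: "x \<in> Simp X 0 \<Longrightarrow> path X x [] x" for x by simp
  have app: "path X x u y \<Longrightarrow> path X y v z \<Longrightarrow> path X x (u @ v) z" for x u y v z
    using path_append by blast
  have c1: "path X x w y \<Longrightarrow> zigzag_class x (w @ rev (map flip w)) x = zigzag_class x [] x" for x w y
    by (rule cls_eq, rule zigzag_rel_cancel)
  have c2: "path X x w y \<Longrightarrow> zigzag_class y (rev (map flip w) @ w) y = zigzag_class y [] y" for x w y
    using c1[OF path_rev] by (simp add: rev_map o_def)
  show ?thesis
  proof
    fix x assume "x \<in> Obj ?G" then show "Id ?G x \<in> Hom ?G x x" unfolding Hom_cls Id Ob using nil by blast
  next
    fix x y z f g assume "f \<in> Hom ?G x y" "g \<in> Hom ?G y z"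
    then obtain u v where p: "path X x u y" "path X y v z"
      and fg: "f = zigzag_class x u y" "g = zigzag_class y v z" unfolding Hom_cls by blast
    show "Comp ?G g f \<in> Hom ?G x z" unfolding Hom_cls fg Comp_cls[OF p] using app[OF p] by blast
  next
    fix x y f assume "f \<in> Hom ?G x y"
    then obtain w where w: "path X x w y" "f = zigzag_class x w y" unfolding Hom_cls by blast
    have n: "path X x [] x" "path X y [] y" using path_ends[OF w(1)] by auto
    show "Inv ?G f \<in> Hom ?G y x" unfolding Hom_cls w(2) Inv_cls[OF w(1)] using path_rev[OF w(1)] by blast
    show "Comp ?G f (Id ?G x) = f" "Comp ?G (Id ?G y) f = f"
      unfolding w(2) Id using Comp_cls[OF n(1) w(1)] Comp_cls[OF w(1) n(2)] by simp_all
    show "Comp ?G (Inv ?G f) f = Id ?G x" "Comp ?G f (Inv ?G f) = Id ?G y"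
      unfolding w(2) Id Inv_cls[OF w(1)] Comp_cls[OF w(1) path_rev[OF w(1)]] Comp_cls[OF path_rev[OF w(1)] w(1)]
      using c1[OF w(1)] c2[OF w(1)] by simp_all
  next
    fix x y z a f g h assume "f \<in> Hom ?G x y" "g \<in> Hom ?G y z" "h \<in> Hom ?G z a"
    then obtain u v w where p: "path X x u y" "path X y v z" "path X z w a"
      and fgh: "f = zigzag_class x u y" "g = zigzag_class y v z" "h = zigzag_class z w a"
      unfolding Hom_cls by blast
    show "Comp ?G h (Comp ?G g f) = Comp ?G (Comp ?G h g) f"
      unfolding fgh Comp_cls[OF p(1,2)] Comp_cls[OF p(2,3)] Comp_cls[OF app[OF p(1,2)] p(3)]
        Comp_cls[OF p(1) app[OF p(2,3)]] by simp
  qed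
qed

end


section \<open>Local coefficient systems and bounded cohomology\<close>

text \<open>The modules attached to different objects may have different carriers and operations; that
  the carriers lie in a common type is no restriction.\<close>

record ('o, 'a, 'r, 'm) seminormed_functor =
  ObjMap :: "'o \<Rightarrow> ('r, 'm) seminormed_module"
  ArrMap :: "'a \<Rightarrow> 'm \<Rightarrow> 'm"

locale seminormed_functor =
  fixes R :: "'r normed_ring" and G :: "('o, 'a) groupoid"
    and A :: "('o, 'a, 'r, 'm) seminormed_functor"
  assumes ObjMap_module: "x \<in> Obj G \<Longrightarrow> seminormed_module R (ObjMap A x)"
    and ArrMap_hom: "\<lbrakk>x \<in> Obj G; y \<in> Obj G; f \<in> Hom G x y\<rbrakk> \<Longrightarrow>
      ArrMap A f \<in> seminormed_hom R (ObjMap A x) (ObjMap A y)"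
    and ArrMap_Id: "\<lbrakk>x \<in> Obj G; a \<in> carrier (ObjMap A x)\<rbrakk> \<Longrightarrow> ArrMap A (Id G x) a = a"
    and ArrMap_Comp: "\<lbrakk>x \<in> Obj G; y \<in> Obj G; z \<in> Obj G; f \<in> Hom G x y; g \<in> Hom G y z;
      a \<in> carrier (ObjMap A x)\<rbrakk> \<Longrightarrow> ArrMap A (Comp G g f) a = ArrMap A g (ArrMap A f a)"

type_synonym ('x, 'r, 'm) local_system = "('x, 'x zigzag set, 'r, 'm) seminormed_functor"

abbreviation seminormed_local_system ::
    "'r normed_ring \<Rightarrow> 'x sset \<Rightarrow> ('x, 'r, 'm) local_system \<Rightarrow> bool" where
  "seminormed_local_system R X A \<equiv> seminormed_functor R (fundamental_groupoid X) A"

definition bounded_cochains ::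
    "'x sset \<Rightarrow> ('x, 'r, 'm) local_system \<Rightarrow> nat \<Rightarrow> ('r, 'x \<Rightarrow> 'm) seminormed_module" where
  "bounded_cochains X A n = bounded_sections (Simp X n) (\<lambda>\<sigma>. ObjMap A (first_vertex X n \<sigma>))"

definition bounded_coboundary ::
    "'x sset \<Rightarrow> ('x, 'r, 'm) local_system \<Rightarrow> nat \<Rightarrow> ('x \<Rightarrow> 'm) \<Rightarrow> 'x \<Rightarrow> 'm" where
  "bounded_coboundary X A n \<phi> = (\<lambda>\<sigma>\<in>Simp X (Suc n).
     let M = ObjMap A (first_vertex X (Suc n) \<sigma>);
         e = edge_class X (front_edge X (Suc n) \<sigma>)
     in ArrMap A (Inv (fundamental_groupoid X) e) (\<phi> (Face X (Suc n) 0 \<sigma>)) \<oplus>\<^bsub>M\<^esub>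
        (\<Oplus>\<^bsub>M\<^esub> i\<in>{1..Suc n}. [((-1::int) ^ i)] \<cdot>\<^bsub>M\<^esub> \<phi> (Face X (Suc n) i \<sigma>)))"

text \<open>Extension by zero to negative degrees; sections over the empty set form the zero module.\<close>

definition bounded_cochains_int ::
    "'x sset \<Rightarrow> ('x, 'r, 'm) local_system \<Rightarrow> int \<Rightarrow> ('r, 'x \<Rightarrow> 'm) seminormed_module" where
  "bounded_cochains_int X A i =
     (if i < 0 then bounded_sections {} (ObjMap A) else bounded_cochains X A (nat i))"

definition bounded_cochain_complex ::
    "'x sset \<Rightarrow> ('x, 'r, 'm) local_system \<Rightarrow> ('r, 'x \<Rightarrow> 'm) seminormed_complex" where
  "bounded_cochain_complex X A =
    \<lparr>Term = bounded_cochains_int X A,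
     Diff = (\<lambda>i \<phi>. if i < 0 then \<zero>\<^bsub>bounded_cochains_int X A (i + 1)\<^esub>
       else bounded_coboundary X A (nat i) \<phi>)\<rparr>"

definition bounded_cohomology ::
    "'x sset \<Rightarrow> ('x, 'r, 'm) local_system \<Rightarrow> int \<Rightarrow> ('x \<Rightarrow> 'm) set monoid" where
  "bounded_cohomology X A i = cohomology (bounded_cochain_complex X A) i"

end

theory Submission
  imports Defs
begin

text \<open>
  A contraction of a Kan complex with trivial homotopy sets up to degree \<open>n\<close> is a coherent choice of
  cones: fixing a vertex \<open>x\<close>, every simplex \<open>\<sigma>\<close> of dimension \<open>m \<le> n\<close> gets a simplex \<open>h \<sigma>\<close> with
  \<open>d\<^sub>0 (h \<sigma>) = \<sigma>\<close> and \<open>d\<^sub>i\<^sub>+\<^sub>1 (h \<sigma>) = h (d\<^sub>i \<sigma>)\<close>. It is built by induction on \<open>m\<close>, since every sphere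
  \<open>\<partial>\<Delta>\<^sup>m\<^sup>+\<^sup>1 \<rightarrow> X\<close> can be filled. Evaluating a cochain on cones and transporting the value along the
  edge from \<open>x\<close> to the first vertex of \<open>\<sigma>\<close> gives a seminorm non-increasing map \<open>s\<close> with \<open>\<delta> (s b) = b\<close>
  for every cocycle \<open>b\<close> of degree \<open>1, \<dots>, n\<close>. So the cohomology vanishes and the uniform boundary
  condition holds with \<open>\<kappa> = 1\<close>; in degrees \<open>\<le> 0\<close> the only coboundary is zero.

  That spheres can be filled is reduced to the hypothesis on simplices with constant boundary as
  follows. Filling a horn shows that it suffices to treat pairs \<open>(y, z)\<close> of simplices with equal
  boundaries. Whether the boundary of a simplex \<open>\<tau>\<close> remains fillable when its face \<open>z\<close> is replaced by \<open>y\<close>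
  does not depend on \<open>\<tau>\<close> or on the position of \<open>z\<close>, and by this freedom \<open>z\<close> can be replaced by the more
  degenerate simplex \<open>s\<^sub>0 (d\<^sub>m z)\<close>, and after \<open>m\<close> such steps by a constant simplex.
\<close>

section \<open>Filling spheres in connected Kan complexes\<close>

text \<open>\<open>N\<close> is the dimension of the faces, so a filler has dimension N + 1.
  Compatibility of the faces is left implicit: any filler forces it.\<close>

definition fillable :: "'x sset \<Rightarrow> nat \<Rightarrow> (nat \<Rightarrow> 'x) \<Rightarrow> bool" where
  "fillable X N b \<longleftrightarrow> (\<exists>\<tau>\<in>Simp X (Suc N). \<forall>i\<le>Suc N. Face X (Suc N) i \<tau> = b i)"

lemma fillable_cong: "(\<And>i. i \<le> Suc N \<Longrightarrow> b i = c i) \<Longrightarrow> fillable X N b \<longleftrightarrow> fillable X N c"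
  by (auto simp: fillable_def)

text \<open>Vertices have no faces, so any two of them are parallel. The guard keeps out
  \<open>Face X 0 i\<close>, which the axioms leave unspecified.\<close>

definition parallel :: "'x sset \<Rightarrow> nat \<Rightarrow> 'x \<Rightarrow> 'x \<Rightarrow> bool" where
  "parallel X N y z \<longleftrightarrow> y \<in> Simp X N \<and> z \<in> Simp X N \<and>
     (0 < N \<longrightarrow> (\<forall>i\<le>N. Face X N i y = Face X N i z))"

abbreviation replaced_boundary :: "'x sset \<Rightarrow> nat \<Rightarrow> 'x \<Rightarrow> nat \<Rightarrow> 'x \<Rightarrow> nat \<Rightarrow> 'x" where
  "replaced_boundary X N \<tau> i y \<equiv> (\<lambda>k. Face X (Suc N) k \<tau>)(i := y)"

text \<open>For parallel \<open>y\<close> and \<open>z\<close> this is homotopy relative to the boundary.\<close>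

definition homotopic :: "'x sset \<Rightarrow> nat \<Rightarrow> 'x \<Rightarrow> 'x \<Rightarrow> bool" where
  "homotopic X N z y \<longleftrightarrow> fillable X N (replaced_boundary X N (Degen X N 0 z) 0 y)"

text \<open>This says that only one homotopy class relative to the boundary has the boundary of
  \<open>z\<close>. Triviality of homotopy sets is used in this form.\<close>

definition boundary_rigid :: "'x sset \<Rightarrow> nat \<Rightarrow> 'x \<Rightarrow> bool" where
  "boundary_rigid X N z \<longleftrightarrow> (\<forall>y. parallel X N y z \<longrightarrow> homotopic X N z y)"

text \<open>The iterates of s_0 interpolate between an arbitrary simplex (\<open>q = 0\<close>) and
  a constant one (\<open>p = 0\<close>).\<close>

primrec iterated_degen :: "'x sset \<Rightarrow> nat \<Rightarrow> nat \<Rightarrow> 'x \<Rightarrow> 'x" where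
  "iterated_degen X p 0 w = w"
| "iterated_degen X p (Suc q) w = Degen X (p + q) 0 (iterated_degen X p q w)"

lemma iterated_degen_zero: "iterated_degen X 0 q w = const_simplex X q w"
  by (induction q) auto

context simplicial_set
begin

lemma iterated_degen_closed: "w \<in> Simp X p \<Longrightarrow> iterated_degen X p q w \<in> Simp X (p + q)"
  by (induction q) (auto intro: Degen_closed)

lemma const_simplex_closed: "x \<in> Simp X 0 \<Longrightarrow> const_simplex X m x \<in> Simp X m"
  by (induction m) (auto intro: Degen_closed)

text \<open>The index of the last face exceeds 1 at each stage, so this face commutes with s_0. This
  identifies the more degenerate simplex in the induction for \<open>boundary_rigid\<close>.\<close>

lemma last_face_iterated_degen:
  assumes "w \<in> Simp X (Suc p)"
  shows "Face X (Suc (p + q)) (Suc (p + q)) (iterated_degen X (Suc p) q w) =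
    iterated_degen X p q (Face X (Suc p) (Suc p) w)"
proof (induction q)
  case (Suc q)
  have "iterated_degen X (Suc p) q w \<in> Simp X (Suc (p + q))"
    using iterated_degen_closed[OF assms] by simp
  then show ?case using Suc Face_Degen_greater[of _ "p + q" 0 "Suc (Suc (p + q))"] by simp
qed simp

lemma Face_const_simplex:
  assumes "x \<in> Simp X 0" "i \<le> Suc m"
  shows "Face X (Suc m) i (const_simplex X (Suc m) x) = const_simplex X m x"
  using assms(2)
proof (induction m arbitrary: i)
  case 0
  then show ?case using assms Face_Degen_eq[of x 0 0] Face_Degen_Suc[of x 0 0] by (cases i) auto
next
  case (Suc m)
  have c: "const_simplex X (Suc m) x \<in> Simp X (Suc m)" by (rule const_simplex_closed[OF assms(1)])
  consider "i = 0" | "i = 1" | "1 < i" by linarith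
  then show ?case
  proof cases
    case 3
    then have "Face X (Suc (Suc m)) i (Degen X (Suc m) 0 (const_simplex X (Suc m) x)) =
        Degen X m 0 (Face X (Suc m) (i - 1) (const_simplex X (Suc m) x))"
      using Face_Degen_greater[OF c, of 0 i] Suc.prems by simp
    also have "\<dots> = Degen X m 0 (const_simplex X m x)"
      using Suc.IH[of "i - 1"] Suc.prems by simp
    finally show ?thesis by simp
  qed (use Face_Degen_eq[OF c, of 0] Face_Degen_Suc[OF c, of 0] in simp_all)
qed

end

section \<open>Replacing one face of a boundary\<close>

context Kan_complex
begin

text \<open>The horn consists of the faces of \<Theta> other than the \<open>b\<close>-th, with the
  \<open>a\<close>-th one replaced by \<open>t\<close>. It is compatible because \<open>t\<close>
  may differ from that face only where it meets the omitted \<open>b\<close>-th face.\<close>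

lemma fillable_neighbour:
  assumes \<Theta>: "\<Theta> \<in> Simp X (Suc (Suc N))" and ab: "a \<le> Suc (Suc N)" "b \<le> Suc (Suc N)" "a \<noteq> b"
    and t: "t \<in> Simp X (Suc N)"
    and t1: "\<And>l. \<lbrakk>l < a; l \<noteq> b\<rbrakk> \<Longrightarrow> Face X (Suc N) l t = Face X (Suc N) l (Face X (Suc (Suc N)) a \<Theta>)"
    and t2: "\<And>l. \<lbrakk>a < l; l \<le> Suc (Suc N); l \<noteq> b\<rbrakk> \<Longrightarrow>
      Face X (Suc N) (l - 1) t = Face X (Suc N) (l - 1) (Face X (Suc (Suc N)) a \<Theta>)"
  obtains \<Xi> where "\<Xi> \<in> Simp X (Suc (Suc N))" "Face X (Suc (Suc N)) a \<Xi> = t"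
    "\<And>k. \<lbrakk>k \<le> Suc (Suc N); k \<noteq> a; k \<noteq> b\<rbrakk> \<Longrightarrow> Face X (Suc (Suc N)) k \<Xi> = Face X (Suc (Suc N)) k \<Theta>"
proof -
  define y where "y = (\<lambda>k. Face X (Suc (Suc N)) k \<Theta>)(a := t)"
  have "horn X (Suc N) b y"
    unfolding horn_def
  proof (intro conjI allI impI)
    fix i assume "i \<le> Suc (Suc N) \<and> i \<noteq> b"
    then show "y i \<in> Simp X (Suc N)" using t Face_closed[OF \<Theta>] by (auto simp: y_def)
  next
    fix i j assume "i < j \<and> j \<le> Suc (Suc N) \<and> i \<noteq> b \<and> j \<noteq> b"
    then show "Face X (Suc N) i (y j) = Face X (Suc N) (j - 1) (y i)"
      using Face_Face[OF \<Theta>, of i j] t1[of i] t2[of j] by (auto simp: y_def)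
  qed
  from horn_filler[OF ab(2) this] obtain \<Xi> where "\<Xi> \<in> Simp X (Suc (Suc N))"
    "\<forall>i. i \<le> Suc (Suc N) \<and> i \<noteq> b \<longrightarrow> Face X (Suc (Suc N)) i \<Xi> = y i" by blast
  then show thesis using ab by (intro that[of \<Xi>]) (auto simp: y_def)
qed

text \<open>The two sides replace the common face of the \<open>i\<close>-th and the \<open>j\<close>-th face of \<open>\<Theta>\<close>.\<close>

lemma fillable_replaced_swap:
  assumes \<Theta>: "\<Theta> \<in> Simp X (Suc (Suc N))" and ij: "i < j" "j \<le> Suc (Suc N)"
  shows "fillable X N (replaced_boundary X N (Face X (Suc (Suc N)) j \<Theta>) i y) \<longleftrightarrow>
    fillable X N (replaced_boundary X N (Face X (Suc (Suc N)) i \<Theta>) (j - 1) y)" (is "?L \<longleftrightarrow> ?R")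
proof
  assume ?L
  then obtain t where t: "t \<in> Simp X (Suc N)"
    and ft: "\<And>l. l \<le> Suc N \<Longrightarrow> Face X (Suc N) l t = (if l = i then y else Face X (Suc N) l (Face X (Suc (Suc N)) j \<Theta>))"
    by (auto simp: fillable_def)
  \<comment> \<open>The horn omits the \<open>i\<close>-th face of \<Theta> and has \<open>t\<close>
    in place of the \<open>j\<close>-th. The new \<open>i\<close>-th face of the filler then has
    \<open>y\<close> where it meets \<open>t\<close> and is unchanged elsewhere, so it is the
    required filler.\<close>
  obtain \<Xi> where \<Xi>: "\<Xi> \<in> Simp X (Suc (Suc N))" "Face X (Suc (Suc N)) j \<Xi> = t"
    "\<And>k. \<lbrakk>k \<le> Suc (Suc N); k \<noteq> j; k \<noteq> i\<rbrakk> \<Longrightarrow> Face X (Suc (Suc N)) k \<Xi> = Face X (Suc (Suc N)) k \<Theta>"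
    by (rule fillable_neighbour[OF \<Theta>, of j i t]) (use ij t ft in auto)
  have "Face X (Suc N) k (Face X (Suc (Suc N)) i \<Xi>) =
      replaced_boundary X N (Face X (Suc (Suc N)) i \<Theta>) (j - 1) y k" if k: "k \<le> Suc N" for k
  proof (cases "k < i")
    case True
    then show ?thesis
      using ij \<Xi>(3)[of k] Face_Face[OF \<Xi>(1), of k i] Face_Face[OF \<Theta>, of k i] by auto
  next
    case False
    then show ?thesis
      using ij k \<Xi>(2) \<Xi>(3)[of "Suc k"] Face_Face[OF \<Xi>(1), of i "Suc k"] Face_Face[OF \<Theta>, of i "Suc k"] ft[of i]
      by (cases "Suc k = j") auto
  qed
  moreover have "Face X (Suc (Suc N)) i \<Xi> \<in> Simp X (Suc N)" using Face_closed[OF \<Xi>(1), of i] ij by simp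
  ultimately show ?R unfolding fillable_def by blast
next
  assume ?R
  then obtain t where t: "t \<in> Simp X (Suc N)"
    and ft: "\<And>l. l \<le> Suc N \<Longrightarrow> Face X (Suc N) l t = (if l = j - 1 then y else Face X (Suc N) l (Face X (Suc (Suc N)) i \<Theta>))"
    by (auto simp: fillable_def)
  obtain \<Xi> where \<Xi>: "\<Xi> \<in> Simp X (Suc (Suc N))" "Face X (Suc (Suc N)) i \<Xi> = t"
    "\<And>k. \<lbrakk>k \<le> Suc (Suc N); k \<noteq> i; k \<noteq> j\<rbrakk> \<Longrightarrow> Face X (Suc (Suc N)) k \<Xi> = Face X (Suc (Suc N)) k \<Theta>"
    by (rule fillable_neighbour[OF \<Theta>, of i j t]) (use ij t ft in auto)
  have "Face X (Suc N) k (Face X (Suc (Suc N)) j \<Xi>) =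
      replaced_boundary X N (Face X (Suc (Suc N)) j \<Theta>) i y k" if k: "k \<le> Suc N" for k
  proof (cases "k < j")
    case True
    then show ?thesis
      using ij k \<Xi>(2) \<Xi>(3)[of k] Face_Face[OF \<Xi>(1), of k j] Face_Face[OF \<Theta>, of k j] ft[of "j - 1"]
      by (cases "k = i") auto
  next
    case False
    then show ?thesis
      using ij k \<Xi>(3)[of "Suc k"] Face_Face[OF \<Xi>(1), of j "Suc k"] Face_Face[OF \<Theta>, of j "Suc k"] by auto
  qed
  then show ?L unfolding fillable_def using Face_closed[OF \<Xi>(1), of j] ij by blast
qed

text \<open>Swapping faces of degenerate simplices over \<tau> replaces \<tau> by a degeneracy of
  its \<open>i\<close>-th face and then moves the position of that face step by step to 0. Hence
  only the replaced face matters.\<close>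

lemma fillable_replaced_iff_homotopic:
  assumes \<tau>: "\<tau> \<in> Simp X (Suc N)" and i: "i \<le> Suc N"
  shows "fillable X N (replaced_boundary X N \<tau> i y) \<longleftrightarrow> homotopic X N (Face X (Suc N) i \<tau>) y"
proof -
  let ?L = "\<lambda>\<tau> i. fillable X N (replaced_boundary X N \<tau> i y)"
  \<comment> \<open>Both equivalences are read off s_(i+1) \<tau>: its \<open>i\<close>-th face is
    s_i (d_i \<tau>), while its faces i + 1 and i + 2 are both \<tau>.\<close>
  have a: "?L \<tau> i \<longleftrightarrow> ?L (Degen X N i (Face X (Suc N) i \<tau>)) i"
    and b: "?L \<tau> i \<longleftrightarrow> ?L (Degen X N i (Face X (Suc N) i \<tau>)) (Suc i)"
    if \<tau>: "\<tau> \<in> Simp X (Suc N)" and "i \<le> N" for \<tau> i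
    using fillable_replaced_swap[OF Degen_closed[OF \<tau>, of "Suc i"], of i "Suc i" y]
      fillable_replaced_swap[OF Degen_closed[OF \<tau>, of "Suc i"], of i "Suc (Suc i)" y]
      Face_Degen_less[OF \<tau>, of i "Suc i"] Face_Degen_eq[OF \<tau>, of "Suc i"]
      Face_Degen_Suc[OF \<tau>, of "Suc i"] that by simp_all
  \<comment> \<open>At the last position i = N + 1 there is no s_(i+1) \<tau>; the last two faces of
    s_N \<tau> are used instead.\<close>
  have c: "?L (Degen X N N (Face X (Suc N) (Suc N) \<tau>)) (Suc N) \<longleftrightarrow> ?L \<tau> (Suc N)"
    using fillable_replaced_swap[OF Degen_closed[OF \<tau>, of N], of "Suc N" "Suc (Suc N)" y]
      Face_Degen_greater[OF \<tau>, of N "Suc (Suc N)"] Face_Degen_Suc[OF \<tau>, of N] by simp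
  define z where "z = Face X (Suc N) i \<tau>"
  have z: "z \<in> Simp X N" unfolding z_def by (rule Face_closed[OF \<tau> i])
  have d: "?L (Degen X N k z) (Suc k) \<longleftrightarrow> ?L (Degen X N k z) k" if "k \<le> N" for k
    using b[of "Degen X N k z" k] that Degen_closed[OF z that] Face_Degen_eq[OF z that] by simp
  \<comment> \<open>The induction passes from s_(k+1) z at position k + 1 to s_k z at the same
    position by \<open>a\<close>, and from there to position k by \<open>d\<close>.\<close>
  have e: "?L (Degen X N k z) k \<longleftrightarrow> homotopic X N z y" if "k \<le> N" for k
    using that
  proof (induction k)
    case (Suc k)
    have "?L (Degen X N k z) (Suc k) \<longleftrightarrow> ?L (Degen X N (Suc k) z) (Suc k)"
      using a[of "Degen X N k z" "Suc k"] Suc.prems Degen_closed[OF z, of k] Face_Degen_Suc[OF z, of k] by simp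
    then show ?case by (metis Suc Suc_leD d)
  qed (simp add: homotopic_def)
  show ?thesis
  proof (cases "i \<le> N")
    case True
    then show ?thesis using a[OF \<tau> True] e[OF True] by (simp add: z_def)
  next
    case False
    then have "i = Suc N" using i by simp
    then show ?thesis using c d[of N] e[of N] by (simp add: z_def)
  qed
qed

text \<open>A homotopy from \<open>z\<close> to \<open>y\<close> has the boundary of s_0 z with face
  0 changed to \<open>y\<close>. Changing that face back to \<open>z\<close> gives a boundary filled
  by s_0 z, and the independence of the ambient simplex turns this into a homotopy from
  \<open>y\<close> to \<open>z\<close>.\<close>

lemma homotopic_sym:
  assumes "homotopic X N z y" "z \<in> Simp X N" shows "homotopic X N y z"
proof -
  from assms(1) obtain \<omega> where \<omega>: "\<omega> \<in> Simp X (Suc N)"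
    and f: "\<And>i. i \<le> Suc N \<Longrightarrow> Face X (Suc N) i \<omega> = replaced_boundary X N (Degen X N 0 z) 0 y i"
    unfolding homotopic_def fillable_def by blast
  have "fillable X N (replaced_boundary X N \<omega> 0 z)"
    unfolding fillable_def
    by (rule bexI[OF _ Degen_closed[OF assms(2), of 0]]) (use f Face_Degen_eq[OF assms(2), of 0] in auto)
  then show ?thesis using fillable_replaced_iff_homotopic[OF \<omega>, of 0 z] f[of 0] by simp
qed

text \<open>Replacing the face \<open>d\<^sub>0\<close> of \<open>s\<^sub>0 z\<close> by \<open>y\<close> and filling the horn opposite to the last vertex turns
  the pair \<open>(y, z)\<close> into a parallel pair whose second entry is more degenerate.\<close>

lemma boundary_rigid_step:
  assumes z: "z \<in> Simp X (Suc p)"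
    and P: "boundary_rigid X (Suc p) (Degen X p 0 (Face X (Suc p) (Suc p) z))"
  shows "boundary_rigid X (Suc p) z"
  unfolding boundary_rigid_def
proof (intro allI impI)
  let ?N = "Suc p"
  fix y assume par: "parallel X ?N y z"
  let ?s = "Degen X ?N 0 z"
  have s: "?s \<in> Simp X (Suc ?N)" using z by (rule Degen_closed) simp
  have s0: "Face X (Suc ?N) 0 ?s = z" using z by (rule Face_Degen_eq) simp
  define b where "b = replaced_boundary X ?N ?s 0 y"
  have yz: "y \<in> Simp X ?N" "\<And>i. i \<le> ?N \<Longrightarrow> Face X ?N i y = Face X ?N i z"
    using par by (auto simp: parallel_def)
  have "horn X ?N (Suc ?N) b"
    unfolding horn_def
  proof (intro conjI allI impI)
    fix i assume "i \<le> Suc ?N \<and> i \<noteq> Suc ?N"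
    then show "b i \<in> Simp X ?N" using yz Face_closed[OF s, of i] by (auto simp: b_def)
  next
    fix i j assume "i < j \<and> j \<le> Suc ?N \<and> i \<noteq> Suc ?N \<and> j \<noteq> Suc ?N"
    then show "Face X ?N i (b j) = Face X ?N (j - 1) (b i)"
      using Face_Face[OF s, of i j] s0 yz(2)[of "j - 1"] by (auto simp: b_def)
  qed
  from horn_filler[OF _ this] obtain T where T: "T \<in> Simp X (Suc ?N)"
    and fT: "\<And>i. i \<le> ?N \<Longrightarrow> Face X (Suc ?N) i T = b i" by force
  let ?y = "Face X (Suc ?N) (Suc ?N) T" and ?z = "Face X (Suc ?N) (Suc ?N) ?s"
  have z1: "?z = Degen X p 0 (Face X ?N ?N z)" using Face_Degen_greater[OF z, of 0 "Suc ?N"] by simp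
  have "Face X ?N i ?y = Face X ?N i ?z" if "i \<le> ?N" for i
    using Face_Face[OF T, of i "Suc ?N"] Face_Face[OF s, of i "Suc ?N"] fT[OF that] yz(2)[of ?N] s0 that
    by (auto simp: b_def)
  then have "parallel X ?N ?y ?z"
    using Face_closed[OF T, of "Suc ?N"] Face_closed[OF s, of "Suc ?N"] by (auto simp: parallel_def)
  with P have "homotopic X ?N ?y ?z"
    using homotopic_sym Face_closed[OF s, of "Suc ?N"] unfolding boundary_rigid_def z1 by auto
  \<comment> \<open>Since the last faces of \<open>T\<close> and of s_0 z are homotopic, the
    boundary of \<open>T\<close> stays fillable with the latter as its last face. The boundary so
    obtained is \<open>b\<close>, and a filler of it is a homotopy from \<open>z\<close> to
    \<open>y\<close>.\<close>
  then have "fillable X ?N (replaced_boundary X ?N T (Suc ?N) ?z)"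
    using fillable_replaced_iff_homotopic[OF T, of "Suc ?N" ?z] by simp
  moreover have "replaced_boundary X ?N T (Suc ?N) ?z i = b i" if "i \<le> Suc ?N" for i
    using fT[of i] that by (auto simp: b_def)
  ultimately show "homotopic X ?N z y"
    unfolding homotopic_def b_def[symmetric] using fillable_cong[of ?N _ b X] by blast
qed

lemma boundary_rigid_const:
  assumes x: "x \<in> Simp X 0" and sing: "is_singleton (homotopy_set X N x)"
  shows "boundary_rigid X N (const_simplex X N x)"
  unfolding boundary_rigid_def
proof (intro allI impI)
  let ?c = "const_simplex X N x"
  fix y assume par: "parallel X N y ?c"
  have c: "?c \<in> spheroids X N x"
    using x const_simplex_closed[OF x] Face_const_simplex[OF x]
    by (cases N) (auto simp: spheroids_def simp del: const_simplex.simps(2))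
  with par have y: "y \<in> spheroids X N x" by (auto simp: spheroids_def parallel_def)
  \<comment> \<open>The constant simplex lies in its own image under the relation, and triviality of
    the homotopy set makes the images of \<open>y\<close> and of the constant simplex equal. This
    yields the pair below without knowing that the relation is an equivalence.\<close>
  have cc: "(?c, ?c) \<in> spheroid_homotopy X N x"
    using c const_simplex_closed[OF x, of "Suc N"] Face_const_simplex[OF x, of _ N]
    unfolding spheroid_homotopy_def
    by (auto intro!: bexI[of _ "const_simplex X (Suc N) x"] simp del: const_simplex.simps)
  have "spheroid_homotopy X N x `` {y} = spheroid_homotopy X N x `` {?c}"
    using sing y c unfolding is_singleton_def homotopy_set_def by (metis quotientI singletonD)
  with cc have "(y, ?c) \<in> spheroid_homotopy X N x" by blast
  then obtain \<omega> where "\<omega> \<in> Simp X (Suc N)" "\<forall>i<N. Face X (Suc N) i \<omega> = ?c"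
    "Face X (Suc N) N \<omega> = y" "Face X (Suc N) (Suc N) \<omega> = ?c"
    by (auto simp: spheroid_homotopy_def)
  \<comment> \<open>The simplicial homotopy carries \<open>y\<close> as face \<open>N\<close>, not
    as face 0, and all its other faces are constant. Position independence bridges the
    difference.\<close>
  then have "fillable X N (replaced_boundary X N (const_simplex X (Suc N) x) N y)"
    using Face_const_simplex[OF x, of _ N] unfolding fillable_def
    by (intro bexI[of _ \<omega>]) (auto simp: le_Suc_eq simp del: const_simplex.simps)
  then show "homotopic X N ?c y"
    using fillable_replaced_iff_homotopic[OF const_simplex_closed[OF x, of "Suc N"], of N y]
      Face_const_simplex[OF x, of N N] by (simp del: const_simplex.simps)
qed

lemma boundary_rigid:
  assumes sing: "\<And>x. x \<in> Simp X 0 \<Longrightarrow> is_singleton (homotopy_set X N x)" and z: "z \<in> Simp X N"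
  shows "boundary_rigid X N z"
proof -
  \<comment> \<open>The claim is generalised so that the induction can trade one dimension of
    \<open>w\<close> for one more degeneracy. At p = 0 the simplex is constant.\<close>
  have "boundary_rigid X N (iterated_degen X p q w)" if "w \<in> Simp X p" "p + q = N" for p q w
    using that
  proof (induction p arbitrary: q w)
    case 0
    then have "w \<in> Simp X 0" "q = N" by simp_all
    then show ?case unfolding iterated_degen_zero using boundary_rigid_const sing by blast
  next
    case (Suc p)
    have N: "N = Suc (p + q)" using Suc.prems by simp
    have "boundary_rigid X N (iterated_degen X p (Suc q) (Face X (Suc p) (Suc p) w))"
      by (rule Suc.IH) (use Suc.prems Face_closed[OF Suc.prems(1), of "Suc p"] in simp_all)
    then have "boundary_rigid X (Suc (p + q))
        (Degen X (p + q) 0 (Face X (Suc (p + q)) (Suc (p + q)) (iterated_degen X (Suc p) q w)))"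
      unfolding N last_face_iterated_degen[OF Suc.prems(1)] by simp
    then show ?case
      unfolding N using iterated_degen_closed[OF Suc.prems(1), of q] by (simp add: boundary_rigid_step)
  qed
  from this[OF z, of 0] show ?thesis by simp
qed

text \<open>Filling the horn without face 0 produces a simplex whose face 0 is parallel to
  \<open>b 0\<close>. By rigidity the two are homotopic, so one may be exchanged for the other in
  the boundary.\<close>

lemma sphere_fillable:
  assumes sing: "\<And>x. x \<in> Simp X 0 \<Longrightarrow> is_singleton (homotopy_set X N x)"
    and b: "\<And>i. i \<le> Suc N \<Longrightarrow> b i \<in> Simp X N"
    and compat: "\<And>i j. \<lbrakk>0 < N; i < j; j \<le> Suc N\<rbrakk> \<Longrightarrow> Face X N i (b j) = Face X N (j - 1) (b i)"
  shows "fillable X N b"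
proof -
  have "horn X N 0 b" using b compat by (cases N) (auto simp: horn_def)
  from horn_filler[OF _ this] obtain T where T: "T \<in> Simp X (Suc N)"
    and fT: "\<And>i. \<lbrakk>i \<le> Suc N; i \<noteq> 0\<rbrakk> \<Longrightarrow> Face X (Suc N) i T = b i" by auto
  have T0: "Face X (Suc N) 0 T \<in> Simp X N" by (rule Face_closed[OF T]) simp
  have "Face X N i (b 0) = Face X N i (Face X (Suc N) 0 T)" if "0 < N" "i \<le> N" for i
  proof -
    have "Face X N i (Face X (Suc N) 0 T) = Face X N 0 (Face X (Suc N) (Suc i) T)"
      using that T Face_Face[of T "N - 1" 0 "Suc i"] by simp
    then show ?thesis using that compat[of 0 "Suc i"] fT[of "Suc i"] by simp
  qed
  then have "parallel X N (b 0) (Face X (Suc N) 0 T)"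
    using b[of 0] T0 by (simp add: parallel_def)
  then have "homotopic X N (Face X (Suc N) 0 T) (b 0)"
    using boundary_rigid[OF sing T0] unfolding boundary_rigid_def by blast
  then have "fillable X N (replaced_boundary X N T 0 (b 0))"
    using fillable_replaced_iff_homotopic[OF T, of 0 "b 0"] by blast
  moreover have "replaced_boundary X N T 0 (b 0) i = b i" if "i \<le> Suc N" for i
    using fT[OF that] by simp
  ultimately show ?thesis using fillable_cong[of N _ b X] by blast
qed

end

section \<open>Coherent cones\<close>

text \<open>Each choice prescribes the faces through the apex to be the cones already chosen one
  dimension lower, so coherence holds as an equality of simplices. The choice is meaningful only
  where a filler exists, which is shown up to dimension \<open>n\<close>.\<close>

primrec cone :: "'x sset \<Rightarrow> 'x \<Rightarrow> nat \<Rightarrow> 'x \<Rightarrow> 'x" where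
  "cone X x 0 v = (SOME \<tau>. \<tau> \<in> Simp X 1 \<and> Face X 1 0 \<tau> = v \<and> Face X 1 1 \<tau> = x)"
| "cone X x (Suc m) \<sigma> = (SOME \<tau>. \<tau> \<in> Simp X (Suc (Suc m)) \<and> Face X (Suc (Suc m)) 0 \<tau> = \<sigma> \<and>
     (\<forall>i\<le>Suc m. Face X (Suc (Suc m)) (Suc i) \<tau> = cone X x m (Face X (Suc m) i \<sigma>)))"

declare cone.simps [simp del]

lemma all_Suc_le_split: "(\<forall>i\<le>Suc m. P i) \<longleftrightarrow> P 0 \<and> (\<forall>i\<le>m. P (Suc i))"
  by (metis Suc_le_mono not0_implies_Suc zero_le)

locale connected_Kan_complex = Kan_complex X for X :: "'x sset" +
  fixes n :: nat and x :: 'x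
  assumes conn: "n_connected n X" and base: "x \<in> Simp X 0"
begin

lemma sphere_fillable_le:
  assumes "N \<le> n" "\<And>i. i \<le> Suc N \<Longrightarrow> b i \<in> Simp X N"
    "\<And>i j. \<lbrakk>0 < N; i < j; j \<le> Suc N\<rbrakk> \<Longrightarrow> Face X N i (b j) = Face X N (j - 1) (b i)"
  shows "\<exists>\<tau>\<in>Simp X (Suc N). \<forall>i\<le>Suc N. Face X (Suc N) i \<tau> = b i"
  using sphere_fillable[of N b] assms conn by (auto simp: n_connected_def fillable_def)

text \<open>This is the path-connected case: the 0-sphere (v, x) is filled by an edge, which as a
  morphism runs from \<open>x\<close> to \<open>v\<close>.\<close>

lemma cone_zero:
  assumes "v \<in> Simp X 0"
  shows "cone X x 0 v \<in> Simp X 1 \<and> Face X 1 0 (cone X x 0 v) = v \<and> Face X 1 1 (cone X x 0 v) = x"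
proof -
  have "\<exists>\<tau>\<in>Simp X (Suc 0). \<forall>i\<le>Suc 0. Face X (Suc 0) i \<tau> = (if i = 0 then v else x)"
    by (rule sphere_fillable_le) (use assms base in auto)
  then have "\<exists>\<tau>. \<tau> \<in> Simp X 1 \<and> Face X 1 0 \<tau> = v \<and> Face X 1 1 \<tau> = x"
    by (auto simp: le_Suc_eq all_conj_distrib)
  then show ?thesis unfolding cone.simps by (rule someI_ex)
qed

text \<open>The simplex and the cones over its faces form a sphere: the induction hypothesis and the
  simplicial identities give compatibility, and the dimension bound allows the sphere to be
  filled.\<close>

lemma cone_Suc:
  assumes "Suc m \<le> n" "\<sigma> \<in> Simp X (Suc m)"
  shows "cone X x (Suc m) \<sigma> \<in> Simp X (Suc (Suc m)) \<and> Face X (Suc (Suc m)) 0 (cone X x (Suc m) \<sigma>) = \<sigma> \<and>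
    (\<forall>i\<le>Suc m. Face X (Suc (Suc m)) (Suc i) (cone X x (Suc m) \<sigma>) = cone X x m (Face X (Suc m) i \<sigma>))"
  using assms
proof (induction m arbitrary: \<sigma>)
  \<comment> \<open>Edges are treated separately, since the cone over a vertex has the apex as face
    1 and not a further cone.\<close>
  case 0
  have d: "Face X (Suc 0) i \<sigma> \<in> Simp X 0" if "i \<le> 1" for i using Face_closed[OF 0(2)] that by simp
  define b where "b = (\<lambda>i. case i of 0 \<Rightarrow> \<sigma> | Suc i \<Rightarrow> cone X x 0 (Face X (Suc 0) i \<sigma>))"
  have "\<exists>\<tau>\<in>Simp X (Suc (Suc 0)). \<forall>i\<le>Suc (Suc 0). Face X (Suc (Suc 0)) i \<tau> = b i"
  proof (rule sphere_fillable_le)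
    fix i j :: nat assume ij: "i < j" "j \<le> Suc (Suc 0)"
    then consider "i = 0" "j = 1" | "i = 0" "j = 2" | "i = 1" "j = 2" by linarith
    then show "Face X (Suc 0) i (b j) = Face X (Suc 0) (j - 1) (b i)"
      by cases (use cone_zero[OF d[of 0]] cone_zero[OF d[of 1]]
        in \<open>simp_all add: b_def numeral_2_eq_2\<close>)
  qed (use 0 cone_zero[OF d] in \<open>auto simp: b_def split: nat.split\<close>)
  then have "\<exists>\<tau>. \<tau> \<in> Simp X (Suc (Suc 0)) \<and> Face X (Suc (Suc 0)) 0 \<tau> = \<sigma> \<and>
     (\<forall>i\<le>Suc 0. Face X (Suc (Suc 0)) (Suc i) \<tau> = cone X x 0 (Face X (Suc 0) i \<sigma>))"
    unfolding Bex_def all_Suc_le_split by (simp add: b_def)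
  then show ?case unfolding cone.simps(2)[of X x 0 \<sigma>] by (rule someI_ex)
next
  case (Suc m)
  let ?N = "Suc (Suc m)"
  have d: "Face X ?N i \<sigma> \<in> Simp X (Suc m)" if "i \<le> ?N" for i using Face_closed[OF Suc.prems(2)] that by simp
  note IH = Suc.IH[OF _ d]
  define b where "b = (\<lambda>i. case i of 0 \<Rightarrow> \<sigma> | Suc i \<Rightarrow> cone X x (Suc m) (Face X ?N i \<sigma>))"
  have "\<exists>\<tau>\<in>Simp X (Suc ?N). \<forall>i\<le>Suc ?N. Face X (Suc ?N) i \<tau> = b i"
  proof (rule sphere_fillable_le)
    fix i assume i: "i \<le> Suc ?N"
    then show "b i \<in> Simp X ?N"
      using Suc.prems IH[of "i - 1"] by (cases i) (auto simp: b_def)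
  next
    fix i j :: nat assume ij: "i < j" "j \<le> Suc ?N"
    show "Face X ?N i (b j) = Face X ?N (j - 1) (b i)"
    proof (cases i)
      case 0
      then show ?thesis using ij Suc.prems IH[of "j - 1"] by (cases j) (auto simp: b_def)
    next
      case (Suc k)
      \<comment> \<open>With i = k + 1 and j = l + 2 both sides are cones over the same
        codimension-two face.\<close>
      define l where "l = j - 2"
      have l: "j = Suc (Suc l)" "k \<le> l" "l \<le> Suc m" using ij Suc by (auto simp: l_def)
      have "Face X ?N i (b j) = cone X x m (Face X (Suc m) k (Face X ?N (Suc l) \<sigma>))"
        using IH[of "Suc l"] l Suc Suc.prems by (auto simp: b_def)
      moreover have "Face X ?N (j - 1) (b i) = cone X x m (Face X (Suc m) l (Face X ?N k \<sigma>))"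
        using IH[of k] l Suc Suc.prems by (auto simp: b_def)
      ultimately show ?thesis using Face_Face[OF Suc.prems(2), of k "Suc l"] l by simp
    qed
  qed (use Suc.prems in simp)
  then have "\<exists>\<tau>. \<tau> \<in> Simp X (Suc ?N) \<and> Face X (Suc ?N) 0 \<tau> = \<sigma> \<and>
     (\<forall>i\<le>?N. Face X (Suc ?N) (Suc i) \<tau> = cone X x (Suc m) (Face X ?N i \<sigma>))"
    unfolding Bex_def all_Suc_le_split[of "Suc (Suc m)"] by (simp add: b_def)
  then show ?case unfolding cone.simps(2)[of X x "Suc m" \<sigma>] by (rule someI_ex)
qed

lemma cone_closed: "\<lbrakk>m \<le> n; \<sigma> \<in> Simp X m\<rbrakk> \<Longrightarrow> cone X x m \<sigma> \<in> Simp X (Suc m)"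
  using cone_zero cone_Suc by (cases m) auto

lemma Face_cone_zero: "\<lbrakk>m \<le> n; \<sigma> \<in> Simp X m\<rbrakk> \<Longrightarrow> Face X (Suc m) 0 (cone X x m \<sigma>) = \<sigma>"
  using cone_zero cone_Suc by (cases m) auto

lemma Face_cone_Suc: "\<lbrakk>Suc m \<le> n; \<sigma> \<in> Simp X (Suc m); i \<le> Suc m\<rbrakk> \<Longrightarrow>
    Face X (Suc (Suc m)) (Suc i) (cone X x (Suc m) \<sigma>) = cone X x m (Face X (Suc m) i \<sigma>)"
  using cone_Suc by auto

text \<open>Deleting the last vertex of a cone gives the cone over the simplex without its last
  vertex. After all deletions the cone over the first vertex remains.\<close>

lemma front_edge_cone:
  assumes "m \<le> n" "\<sigma> \<in> Simp X m"
  shows "front_face X 1 m (cone X x m \<sigma>) = cone X x 0 (first_vertex X m \<sigma>)"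
  using assms
proof (induction m arbitrary: \<sigma>)
  case (Suc m)
  then show ?case
    using Face_cone_Suc[of m \<sigma> "Suc m"] Face_closed[of \<sigma> m "Suc m"] by simp
qed simp

lemma first_vertex_cone:
  assumes "m \<le> n" "\<sigma> \<in> Simp X m"
  shows "first_vertex X (Suc m) (cone X x m \<sigma>) = x"
  using assms
proof (induction m arbitrary: \<sigma>)
  case 0
  then show ?case using cone_zero[of \<sigma>] by simp
next
  case (Suc m)
  then show ?case
    using Face_cone_Suc[of m \<sigma> "Suc m"] Face_closed[of \<sigma> m "Suc m"] by simp
qed

end

section \<open>Front faces and classes of edges\<close>

context simplicial_set
begin

lemma front_face_closed: "\<sigma> \<in> Simp X (k + m) \<Longrightarrow> front_face X k m \<sigma> \<in> Simp X k"
  by (induction m arbitrary: \<sigma>) (auto intro: Face_closed)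

lemma Face_front_face:
  assumes "\<sigma> \<in> Simp X (Suc k + m)" "i \<le> k"
  shows "Face X (Suc k) i (front_face X (Suc k) m \<sigma>) = front_face X k m (Face X (Suc k + m) i \<sigma>)"
  using assms
proof (induction m arbitrary: \<sigma>)
  case (Suc m)
  have "Face X (Suc (k + m)) i (Face X (Suc (Suc (k + m))) (Suc (Suc (k + m))) \<sigma>) =
      Face X (Suc (k + m)) (Suc (k + m)) (Face X (Suc (Suc (k + m))) i \<sigma>)"
    using Face_Face[of \<sigma> "k + m" i "Suc (Suc (k + m))"] Suc.prems by simp
  then show ?case
    using Suc.IH[of "Face X (Suc (Suc (k + m))) (Suc (Suc (k + m))) \<sigma>"] Suc.prems
      Face_closed[of \<sigma> "Suc (k + m)" "Suc (Suc (k + m))"] by simp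
qed simp

lemma last_Face_front_face: "Face X (Suc k) (Suc k) (front_face X (Suc k) m \<sigma>) = front_face X k (Suc m) \<sigma>"
  by (induction m arbitrary: \<sigma>) auto

lemma front_face_Face:
  assumes "\<sigma> \<in> Simp X (Suc (k + m))" "k < i" "i \<le> Suc (k + m)"
  shows "front_face X k m (Face X (Suc (k + m)) i \<sigma>) = front_face X k (Suc m) \<sigma>"
  using assms
proof (induction m arbitrary: \<sigma> i)
  case 0
  then have "i = Suc k" by simp
  then show ?case by simp
next
  case (Suc m)
  show ?case
  proof (cases "i = Suc (k + Suc m)")
    case False
    have "Face X (Suc (k + m)) (Suc (k + m)) (Face X (Suc (Suc (k + m))) i \<sigma>) =
       Face X (Suc (k + m)) i (Face X (Suc (Suc (k + m))) (Suc (Suc (k + m))) \<sigma>)"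
      using Face_Face[of \<sigma> "k + m" i "Suc (Suc (k + m))"] Suc.prems False by simp
    then show ?thesis
      using Suc.IH[of "Face X (Suc (Suc (k + m))) (Suc (Suc (k + m))) \<sigma>" i] Suc.prems False
        Face_closed[of \<sigma> "Suc (k + m)" "Suc (Suc (k + m))"] by simp
  qed simp
qed

lemma edge_class_Hom:
  assumes "e \<in> Simp X 1"
  shows "edge_class X e \<in> Hom (fundamental_groupoid X) (Face X 1 1 e) (Face X 1 0 e)"
proof -
  have "path X (Face X 1 1 e) [Fwd e] (Face X 1 0 e)"
    using assms source_target_closed[of "Fwd e"] by simp
  then show ?thesis unfolding Hom_cls edge_class_def by blast
qed

lemma edge_class_triangle:
  assumes "\<sigma> \<in> Simp X 2"
  shows "Comp (fundamental_groupoid X) (edge_class X (Face X 2 0 \<sigma>)) (edge_class X (Face X 2 2 \<sigma>)) =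
    edge_class X (Face X 2 1 \<sigma>)"
proof -
  have c: "Face X 2 i \<sigma> \<in> Simp X 1" if "i \<le> 2" for i using triangle_faces(1)[OF assms, of i] that by simp
  note t = triangle_faces(2-4)[OF assms]
  let ?a = "Face X 1 1 (Face X 2 2 \<sigma>)" and ?b = "Face X 1 0 (Face X 2 2 \<sigma>)" and ?c = "Face X 1 0 (Face X 2 0 \<sigma>)"
  have p: "path X ?a [Fwd (Face X 2 2 \<sigma>)] ?b" "path X ?b [Fwd (Face X 2 0 \<sigma>)] ?c"
    using c[of 2] c[of 0] t source_target_closed[of "Fwd (Face X 2 2 \<sigma>)"]
      source_target_closed[of "Fwd (Face X 2 0 \<sigma>)"] by simp_all
  have "path X ?a ([] @ [Fwd (Face X 2 2 \<sigma>), Fwd (Face X 2 0 \<sigma>)] @ []) ?c"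
    using p by simp
  from zigzag_triangle[OF assms this]
  have "zigzag_class ?a [Fwd (Face X 2 2 \<sigma>), Fwd (Face X 2 0 \<sigma>)] ?c = zigzag_class ?a [Fwd (Face X 2 1 \<sigma>)] ?c"
    by (intro cls_eq) simp
  then show ?thesis using Comp_cls[OF p] t unfolding edge_class_def by simp
qed

end

section \<open>Modules of bounded sections\<close>

text \<open>The sign (-1)^i is encoded by parity, so that sign computations use only negation.
  \<open>add_pow_minus_one_power\<close> links it to the integer multiple in the
  differential.\<close>

definition signed :: "('a, 'm) ring_scheme \<Rightarrow> nat \<Rightarrow> 'a \<Rightarrow> 'a" where
  "signed G i a = (if even i then a else \<ominus>\<^bsub>G\<^esub> a)"

lemma abelian_group_hom_finsum:
  assumes "abelian_group_hom G H h" "f \<in> A \<rightarrow> carrier G"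
  shows "h (finsum G f A) = finsum H (\<lambda>i. h (f i)) A"
proof -
  interpret abelian_group_hom G H h by fact
  have "h (finsum G f A) = finsum H (\<lambda>i. h (f i)) A \<and> finsum G f A \<in> carrier G"
    using assms(2)
  proof (induction A rule: infinite_finite_induct)
    case (insert a A)
    then have "f \<in> A \<rightarrow> carrier G" "f a \<in> carrier G" by auto
    with insert show ?case by (simp add: Pi_def)
  qed (auto simp: G.finsum_infinite H.finsum_infinite)
  then show ?thesis ..
qed

context abelian_group
begin

lemma signed_closed [simp]: "a \<in> carrier G \<Longrightarrow> signed G i a \<in> carrier G"
  by (simp add: signed_def)

lemma signed_signed: "a \<in> carrier G \<Longrightarrow> signed G i (signed G j a) = signed G (i + j) a"
  by (auto simp: signed_def)

lemma add_pow_minus_one_power: "a \<in> carrier G \<Longrightarrow> [((-1::int) ^ i)] \<cdot>\<^bsub>G\<^esub> a = signed G i a"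
  using add.int_pow_neg[of a 1] add.int_pow_1[of a] by (simp add: signed_def minus_one_power_iff)

lemma signed_hom: "abelian_group_hom G G (signed G i)"
  by (auto intro!: abelian_group_homI abelian_group_axioms simp: signed_def minus_add hom_def
      group_hom_def group_hom_axioms_def a_group)

lemma finsum_Times:
  assumes "finite A" "finite B" "f \<in> A \<times> B \<rightarrow> carrier G"
  shows "finsum G f (A \<times> B) = finsum G (\<lambda>a. finsum G (\<lambda>b. f (a, b)) B) A"
proof -
  have "A \<times> B = (\<Union>a\<in>A. Pair a ` B)" by auto
  moreover have "finsum G f (\<Union>a\<in>A. Pair a ` B) = finsum G (\<lambda>a. finsum G f (Pair a ` B)) A"
    using assms by (intro add.finprod_UN_disjoint) (auto simp: pairwise_def disjnt_def)
  ultimately have "finsum G f (A \<times> B) = finsum G (\<lambda>a. finsum G f (Pair a ` B)) A" by simp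
  also have "\<dots> = finsum G (\<lambda>a. finsum G (\<lambda>b. f (a, b)) B) A"
  proof (rule add.finprod_cong')
    fix a assume "a \<in> A"
    then show "finsum G f (Pair a ` B) = finsum G (\<lambda>b. f (a, b)) B"
      using assms(3) by (subst add.finprod_reindex) (auto simp: inj_on_def)
  qed (use assms(3) in \<open>auto intro!: finsum_closed\<close>)
  finally show ?thesis .
qed

text \<open>The terms \<open>(i, j)\<close> with \<open>j < i\<close> cancel against the terms \<open>(j, i - 1)\<close>.\<close>

lemma alternating_double_sum_zero:
  assumes g: "\<And>i j. \<lbrakk>i \<le> Suc k; j \<le> k\<rbrakk> \<Longrightarrow> g i j \<in> carrier G"
    and sym: "\<And>i j. \<lbrakk>i < j; j \<le> Suc k\<rbrakk> \<Longrightarrow> g j i = g i (j - 1)"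
  shows "finsum G (\<lambda>i. signed G i (finsum G (\<lambda>j. signed G j (g i j)) {..k})) {..Suc k} = \<zero>"
proof -
  let ?F = "\<lambda>(i, j). signed G (i + j) (g i j)" and ?h = "\<lambda>(i, j). (j, i - 1 :: nat)"
  define L where "L = {(i, j). i \<le> Suc k \<and> j < i}"
  define U where "U = {(i, j). i \<le> j \<and> j \<le> k}"
  have P: "{..Suc k} \<times> {..k} = L \<union> U" "L \<inter> U = {}" by (auto simp: L_def U_def)
  then have fin: "finite L" "finite U" by (metis finite_Un finite_atMost finite_cartesian_product)+
  have "(i, j) \<in> ?h ` L" if "i \<le> j" "j \<le> k" for i j
    using that by (intro image_eqI[of _ _ "(Suc j, i)"]) (auto simp: L_def)
  then have U: "U = ?h ` L" by (auto simp: L_def U_def)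
  have inj: "inj_on ?h L" by (auto simp: inj_on_def L_def)
  have F: "?F p \<in> carrier G" if "p \<in> L \<or> p \<in> U" for p
    using that g by (auto simp: L_def U_def)
  have "finsum G (\<lambda>i. signed G i (finsum G (\<lambda>j. signed G j (g i j)) {..k})) {..Suc k} =
      finsum G (\<lambda>i. finsum G (\<lambda>j. ?F (i, j)) {..k}) {..Suc k}"
  proof (rule add.finprod_cong')
    fix i assume i: "i \<in> {..Suc k}"
    have "signed G i (finsum G (\<lambda>j. signed G j (g i j)) {..k}) =
        finsum G (\<lambda>j. signed G i (signed G j (g i j))) {..k}"
      using g i by (intro abelian_group_hom_finsum[OF signed_hom]) auto
    also have "\<dots> = finsum G (\<lambda>j. ?F (i, j)) {..k}"
      using g i by (intro add.finprod_cong') (auto simp: signed_signed)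
    finally show "signed G i (finsum G (\<lambda>j. signed G j (g i j)) {..k}) = finsum G (\<lambda>j. ?F (i, j)) {..k}" .
  qed (use g in \<open>auto intro!: finsum_closed\<close>)
  also have "\<dots> = finsum G ?F ({..Suc k} \<times> {..k})"
    using g by (subst finsum_Times) auto
  also have "\<dots> = finsum G ?F L \<oplus> finsum G ?F U"
    unfolding P(1) using F fin P(2) by (intro add.finprod_Un_disjoint) blast+
  also have "finsum G ?F U = finsum G (\<lambda>p. ?F (?h p)) L"
    unfolding U using F U inj by (intro add.finprod_reindex) blast+
  also have "finsum G ?F L \<oplus> finsum G (\<lambda>p. ?F (?h p)) L = finsum G (\<lambda>p. ?F p \<oplus> ?F (?h p)) L"
    using F U by (intro add.finprod_multf[symmetric]) blast+
  also have "\<dots> = \<zero>"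
  proof (rule add.finprod_one_eqI)
    fix p assume p: "p \<in> L"
    obtain i j where ij: "p = (i, j)" "j < i" "i \<le> Suc k" using p by (auto simp: L_def)
    \<comment> \<open>The index sums i + j and j + (i - 1) have opposite parity, since i > 0 on
      \<open>L\<close>; the values agree by \<open>sym\<close>.\<close>
    have "?F (?h p) = \<ominus> ?F p"
      using ij sym[OF ij(2,3)] g[of i j] by (cases i) (auto simp: signed_def)
    then show "?F p \<oplus> ?F (?h p) = \<zero>" using F[of p] p by (simp add: r_neg)
  qed
  finally show ?thesis .
qed

end

section \<open>Quotients of a group by itself\<close>

lemma (in group) trivial_group_Mod_carrier: "trivial_group (G Mod carrier G)"
proof -
  have "carrier G \<lhd> G" by (rule normal_invI) (auto intro: subgroup_self)
  then have "group (G Mod carrier G)" by (rule normal.factorgroup_is_group)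
  moreover have "carrier (G Mod carrier G) = {carrier G}"
    using coset_join2[OF _ subgroup_self] by (auto simp: FactGroup_def RCOSETS_def)
  ultimately show ?thesis by (auto simp: trivial_group_def FactGroup_def)
qed

lemma trivial_A_Mod_a_kernel:
  assumes "abelian_group_hom G H h"
  shows "trivial_group (G\<lparr>carrier := a_kernel G H h\<rparr> A_Mod a_kernel G H h)"
proof -
  interpret abelian_group_hom G H h by fact
  have "group ((add_monoid G)\<lparr>carrier := a_kernel G H h\<rparr>)"
    using additive_subgroup_a_kernel by (intro subgroup.subgroup_is_group) (auto simp: additive_subgroup_def a_group)
  from group.trivial_group_Mod_carrier[OF this] show ?thesis by (simp add: A_FactGroup_def)
qed

section \<open>Seminorm estimates and bounded sections\<close>

context seminormed_module
begin

text \<open>This is the module inequality for r = 1. The factor appears because the norm of the unit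
  is not prescribed.\<close>

lemma seminorm_add_le:
  "\<lbrakk>a \<in> carrier M; b \<in> carrier M\<rbrakk> \<Longrightarrow> seminorm M (a \<oplus>\<^bsub>M\<^esub> b) \<le> rnorm R \<one>\<^bsub>R\<^esub> * seminorm M a + seminorm M b"
  using seminorm_smult_add[of "\<one>\<^bsub>R\<^esub>" a b] by (simp add: smult_one)

lemma smult_minus_one: assumes "a \<in> carrier M" shows "(\<ominus>\<^bsub>R\<^esub> \<one>\<^bsub>R\<^esub>) \<odot>\<^bsub>M\<^esub> a = \<ominus>\<^bsub>M\<^esub> a"
proof -
  have z: "\<zero>\<^bsub>R\<^esub> \<odot>\<^bsub>M\<^esub> a = \<zero>\<^bsub>M\<^esub>"
    using smult_l_distr[of "\<zero>\<^bsub>R\<^esub>" "\<zero>\<^bsub>R\<^esub>" a] smult_closed[of "\<zero>\<^bsub>R\<^esub>" a] assms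
    by (simp add: M.add.l_cancel_one)
  have "(\<ominus>\<^bsub>R\<^esub> \<one>\<^bsub>R\<^esub>) \<odot>\<^bsub>M\<^esub> a \<oplus>\<^bsub>M\<^esub> a = (\<ominus>\<^bsub>R\<^esub> \<one>\<^bsub>R\<^esub> \<oplus>\<^bsub>R\<^esub> \<one>\<^bsub>R\<^esub>) \<odot>\<^bsub>M\<^esub> a"
    using smult_l_distr[of "\<ominus>\<^bsub>R\<^esub> \<one>\<^bsub>R\<^esub>" "\<one>\<^bsub>R\<^esub>" a] assms by (simp add: smult_one)
  also have "\<dots> = \<zero>\<^bsub>M\<^esub>" using z by (simp add: R.l_neg)
  finally show ?thesis using assms smult_closed[of "\<ominus>\<^bsub>R\<^esub> \<one>\<^bsub>R\<^esub>" a] by (simp add: M.minus_equality)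
qed

lemma seminorm_minus_le:
  assumes "a \<in> carrier M" shows "seminorm M (\<ominus>\<^bsub>M\<^esub> a) \<le> rnorm R (\<ominus>\<^bsub>R\<^esub> \<one>\<^bsub>R\<^esub>) * seminorm M a"
  using seminorm_smult_add[of "\<ominus>\<^bsub>R\<^esub> \<one>\<^bsub>R\<^esub>" a "\<zero>\<^bsub>M\<^esub>"] assms
  by (simp add: smult_minus_one seminorm_zero)

text \<open>The maximum covers both parities at once, so the bound does not depend on
  \<open>i\<close>.\<close>

lemma seminorm_signed_le:
  assumes "a \<in> carrier M"
  shows "seminorm M (signed M i a) \<le> max 1 (rnorm R (\<ominus>\<^bsub>R\<^esub> \<one>\<^bsub>R\<^esub>)) * seminorm M a"
proof -
  have "c * seminorm M a \<le> max 1 (rnorm R (\<ominus>\<^bsub>R\<^esub> \<one>\<^bsub>R\<^esub>)) * seminorm M a"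
    if "c \<le> max 1 (rnorm R (\<ominus>\<^bsub>R\<^esub> \<one>\<^bsub>R\<^esub>))" for c
    using that seminorm_nonneg[OF assms] by (rule mult_right_mono)
  from this[of 1] this[of "rnorm R (\<ominus>\<^bsub>R\<^esub> \<one>\<^bsub>R\<^esub>)"] show ?thesis
    using seminorm_minus_le[OF assms] by (auto simp: signed_def)
qed

text \<open>In each addition the factor falls on the newly added summand only, hence it does not
  accumulate.\<close>

lemma seminorm_finsum_le:
  assumes "finite S" "f \<in> S \<rightarrow> carrier M"
  shows "seminorm M (finsum M f S) \<le> rnorm R \<one>\<^bsub>R\<^esub> * (\<Sum>i\<in>S. seminorm M (f i))"
  using assms
proof (induction S)
  case empty
  then show ?case by (simp add: seminorm_zero)
next
  case (insert s S)
  then have "f s \<in> carrier M" "f \<in> S \<rightarrow> carrier M" by auto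
  with insert seminorm_add_le[of "f s" "finsum M f S"] show ?case by (simp add: distrib_left)
qed

end

lemma bounded_sections_simps:
  "carrier (bounded_sections I M) =
     {\<phi> \<in> (\<Pi>\<^sub>E i\<in>I. carrier (M i)). bdd_above ((\<lambda>i. seminorm (M i) (\<phi> i)) ` I)}"
  "\<zero>\<^bsub>bounded_sections I M\<^esub> = (\<lambda>i\<in>I. \<zero>\<^bsub>M i\<^esub>)"
  "\<phi> \<oplus>\<^bsub>bounded_sections I M\<^esub> \<psi> = (\<lambda>i\<in>I. \<phi> i \<oplus>\<^bsub>M i\<^esub> \<psi> i)"
  "seminorm (bounded_sections I M) \<phi> = Sup (insert 0 ((\<lambda>i. seminorm (M i) (\<phi> i)) ` I))"
  by (simp_all add: bounded_sections_def)

lemma bounded_sectionsI: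
  assumes "\<phi> \<in> (\<Pi>\<^sub>E i\<in>I. carrier (M i))" "\<And>i. i \<in> I \<Longrightarrow> seminorm (M i) (\<phi> i) \<le> B"
  shows "\<phi> \<in> carrier (bounded_sections I M)"
  using assms by (auto simp: bounded_sections_simps intro!: bdd_aboveI2)

lemma bounded_sections_closed: "\<lbrakk>\<phi> \<in> carrier (bounded_sections I M); i \<in> I\<rbrakk> \<Longrightarrow> \<phi> i \<in> carrier (M i)"
  by (auto simp: bounded_sections_simps)

lemma bounded_sections_eqI:
  assumes "\<phi> \<in> carrier (bounded_sections I M)" "\<psi> \<in> carrier (bounded_sections I M)"
    "\<And>i. i \<in> I \<Longrightarrow> \<phi> i = \<psi> i"
  shows "\<phi> = \<psi>"
  using assms by (auto simp: bounded_sections_simps intro: PiE_ext)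

lemma seminorm_le_bounded_sections:
  assumes "\<phi> \<in> carrier (bounded_sections I M)" "i \<in> I"
  shows "seminorm (M i) (\<phi> i) \<le> seminorm (bounded_sections I M) \<phi>"
  using assms by (auto simp: bounded_sections_simps intro!: cSup_upper)

lemma bounded_sections_seminorm_nonneg:
  assumes "\<phi> \<in> carrier (bounded_sections I M)"
  shows "0 \<le> seminorm (bounded_sections I M) \<phi>"
  using assms by (auto simp: bounded_sections_simps intro!: cSup_upper)

lemma bounded_sections_seminorm_le:
  assumes "0 \<le> B" "\<And>i. i \<in> I \<Longrightarrow> seminorm (M i) (\<phi> i) \<le> B"
  shows "seminorm (bounded_sections I M) \<phi> \<le> B"
  using assms by (auto simp: bounded_sections_simps intro!: cSup_least)

lemma abelian_group_bounded_sections: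
  assumes M: "\<And>i. i \<in> I \<Longrightarrow> seminormed_module R (M i)"
  shows "abelian_group (bounded_sections I M)" (is "abelian_group ?S")
proof -
  have ag: "abelian_group (M i)" if "i \<in> I" for i
    using M[OF that] by (simp add: seminormed_module_def left_module_def)
  note [simp] = abelian_groupE(1,2)[OF ag] abelian_groupE(5)[OF ag] bounded_sections_closed
  show ?thesis
  proof (rule abelian_groupI)
    fix \<phi> \<psi> assume *: "\<phi> \<in> carrier ?S" "\<psi> \<in> carrier ?S"
    show "\<phi> \<oplus>\<^bsub>?S\<^esub> \<psi> \<in> carrier ?S"
    proof (rule bounded_sectionsI)
      fix i assume i: "i \<in> I"
      \<comment> \<open>The absolute value makes the factor nonnegative, as monotonicity of
        multiplication requires.\<close>
      have "rnorm R \<one>\<^bsub>R\<^esub> * seminorm (M i) (\<phi> i) \<le> \<bar>rnorm R \<one>\<^bsub>R\<^esub>\<bar> * seminorm ?S \<phi>"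
        using seminorm_le_bounded_sections[OF *(1) i] seminormed_module.seminorm_nonneg[OF M[OF i], of "\<phi> i"] * i
        by (intro mult_mono) auto
      then show "seminorm (M i) ((\<phi> \<oplus>\<^bsub>?S\<^esub> \<psi>) i) \<le> \<bar>rnorm R \<one>\<^bsub>R\<^esub>\<bar> * seminorm ?S \<phi> + seminorm ?S \<psi>"
        using seminormed_module.seminorm_add_le[OF M[OF i], of "\<phi> i" "\<psi> i"]
          seminorm_le_bounded_sections[OF *(2) i] * i by (simp add: bounded_sections_simps(3))
    qed (use * in \<open>auto simp: bounded_sections_simps(3)\<close>)
    show "\<phi> \<oplus>\<^bsub>?S\<^esub> \<psi> = \<psi> \<oplus>\<^bsub>?S\<^esub> \<phi>"
      using * by (auto simp: bounded_sections_simps(3) fun_eq_iff restrict_def abelian_groupE(4)[OF ag])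
  next
    show "\<zero>\<^bsub>?S\<^esub> \<in> carrier ?S"
      using M by (intro bounded_sectionsI[where B = 0])
        (auto simp: bounded_sections_simps(2) intro: eq_refl[OF seminormed_module.seminorm_zero])
  next
    fix \<phi> \<psi> \<chi> assume "\<phi> \<in> carrier ?S" "\<psi> \<in> carrier ?S" "\<chi> \<in> carrier ?S"
    then show "\<phi> \<oplus>\<^bsub>?S\<^esub> \<psi> \<oplus>\<^bsub>?S\<^esub> \<chi> = \<phi> \<oplus>\<^bsub>?S\<^esub> (\<psi> \<oplus>\<^bsub>?S\<^esub> \<chi>)"
      by (auto simp: bounded_sections_simps(3) fun_eq_iff restrict_def abelian_groupE(3)[OF ag])
  next
    fix \<phi> assume \<phi>: "\<phi> \<in> carrier ?S"
    have "(\<zero>\<^bsub>?S\<^esub> \<oplus>\<^bsub>?S\<^esub> \<phi>) i = \<phi> i" for i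
      using \<phi> by (cases "i \<in> I") (auto simp: bounded_sections_simps intro: PiE_arb[symmetric])
    then show "\<zero>\<^bsub>?S\<^esub> \<oplus>\<^bsub>?S\<^esub> \<phi> = \<phi>" by blast
    let ?m = "\<lambda>i\<in>I. \<ominus>\<^bsub>M i\<^esub> \<phi> i"
    have "?m \<in> carrier ?S"
    proof (rule bounded_sectionsI)
      fix i assume i: "i \<in> I"
      have "rnorm R (\<ominus>\<^bsub>R\<^esub> \<one>\<^bsub>R\<^esub>) * seminorm (M i) (\<phi> i) \<le> \<bar>rnorm R (\<ominus>\<^bsub>R\<^esub> \<one>\<^bsub>R\<^esub>)\<bar> * seminorm ?S \<phi>"
        using seminorm_le_bounded_sections[OF \<phi> i] seminormed_module.seminorm_nonneg[OF M[OF i], of "\<phi> i"] \<phi> i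
        by (intro mult_mono) auto
      then show "seminorm (M i) (?m i) \<le> \<bar>rnorm R (\<ominus>\<^bsub>R\<^esub> \<one>\<^bsub>R\<^esub>)\<bar> * seminorm ?S \<phi>"
        using seminormed_module.seminorm_minus_le[OF M[OF i], of "\<phi> i"] \<phi> i by simp
    qed (use \<phi> ag in \<open>auto intro: abelian_group.a_inv_closed\<close>)
    moreover have "?m \<oplus>\<^bsub>?S\<^esub> \<phi> = \<zero>\<^bsub>?S\<^esub>"
      using \<phi> ag by (auto simp: bounded_sections_simps(2,3) fun_eq_iff restrict_def abelian_group.l_neg)
    ultimately show "\<exists>\<psi>\<in>carrier ?S. \<psi> \<oplus>\<^bsub>?S\<^esub> \<phi> = \<zero>\<^bsub>?S\<^esub>" by blast
  qed
qed

section \<open>Bounded cochains with local coefficients\<close>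

declare front_face.simps(2) [simp del]

text \<open>The map from the coefficients at the first vertex of the \<open>i\<close>-th face of \<open>\<sigma>\<close> to those at
  the first vertex of \<open>\<sigma>\<close>.\<close>

definition face_transport :: "'x sset \<Rightarrow> ('x, 'r, 'm) local_system \<Rightarrow> nat \<Rightarrow> 'x \<Rightarrow> nat \<Rightarrow> 'm \<Rightarrow> 'm" where
  "face_transport X A n \<sigma> i a =
    (if i = 0 then ArrMap A (Inv (fundamental_groupoid X) (edge_class X (front_edge X (Suc n) \<sigma>))) a else a)"

locale local_coefficients = simplicial_set X + seminormed_functor R "fundamental_groupoid X" A
  for R :: "'r normed_ring" and X :: "'x sset" and A :: "('x, 'r, 'm) local_system"
begin

abbreviation "G \<equiv> fundamental_groupoid X"
abbreviation "C n \<equiv> bounded_cochains X A n"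
abbreviation "\<delta> n \<equiv> bounded_coboundary X A n"

sublocale groupoid G by (rule groupoid_fundamental_groupoid)

lemma Obj_G [simp]: "Obj G = Simp X 0" by (simp add: fundamental_groupoid_def)

lemma coefficient_group: "v \<in> Simp X 0 \<Longrightarrow> abelian_group (ObjMap A v)"
  using ObjMap_module[of v] by (simp add: seminormed_module_def left_module_def)

lemma ArrMap_group_hom:
  assumes "u \<in> Simp X 0" "v \<in> Simp X 0" "f \<in> Hom G u v"
  shows "abelian_group_hom (ObjMap A u) (ObjMap A v) (ArrMap A f)"
  using ArrMap_hom[of u v f] assms
  by (intro abelian_group_homI coefficient_group)
    (auto simp: seminormed_hom_def group_hom_def group_hom_axioms_def hom_def abelian_group.a_group coefficient_group)

lemma ArrMap_closed:
  "\<lbrakk>u \<in> Simp X 0; v \<in> Simp X 0; f \<in> Hom G u v; a \<in> carrier (ObjMap A u)\<rbrakk> \<Longrightarrow> ArrMap A f a \<in> carrier (ObjMap A v)"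
  using ArrMap_hom[of u v f] by (auto simp: seminormed_hom_def)

lemma seminorm_ArrMap_le:
  "\<lbrakk>u \<in> Simp X 0; v \<in> Simp X 0; f \<in> Hom G u v; a \<in> carrier (ObjMap A u)\<rbrakk> \<Longrightarrow>
    seminorm (ObjMap A v) (ArrMap A f a) \<le> seminorm (ObjMap A u) a"
  using ArrMap_hom[of u v f] by (auto simp: seminormed_hom_def)

lemma ArrMap_Inv_left:
  assumes "u \<in> Simp X 0" "v \<in> Simp X 0" "f \<in> Hom G u v" "a \<in> carrier (ObjMap A u)"
  shows "ArrMap A (Inv G f) (ArrMap A f a) = a"
  using assms ArrMap_Comp[of u v u f "Inv G f" a] Inv_closed[of u v f] Inv_Comp[of u v f] ArrMap_Id[of u a] by simp

lemma ArrMap_Inv_right: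
  assumes "u \<in> Simp X 0" "v \<in> Simp X 0" "f \<in> Hom G u v" "a \<in> carrier (ObjMap A v)"
  shows "ArrMap A f (ArrMap A (Inv G f) a) = a"
  using assms ArrMap_Comp[of v u v "Inv G f" f a] Inv_closed[of u v f] Comp_Inv[of u v f] ArrMap_Id[of v a] by simp

lemma ArrMap_triangle:
  assumes "\<sigma> \<in> Simp X 2" "a \<in> carrier (ObjMap A (Face X 1 1 (Face X 2 2 \<sigma>)))"
  shows "ArrMap A (edge_class X (Face X 2 1 \<sigma>)) a =
    ArrMap A (edge_class X (Face X 2 0 \<sigma>)) (ArrMap A (edge_class X (Face X 2 2 \<sigma>)) a)"
proof -
  have c: "Face X 2 i \<sigma> \<in> Simp X 1" if "i \<le> 2" for i using triangle_faces(1)[OF assms(1), of i] that by simp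
  have d: "Face X 1 i (Face X 2 j \<sigma>) \<in> Simp X 0" if "j \<le> 2" "i \<le> 1" for i j
    using Face_closed[of "Face X 2 j \<sigma>" 0 i] c that by simp
  note t = triangle_faces(2-4)[OF assms(1)]
  show ?thesis
    unfolding edge_class_triangle[OF assms(1), symmetric]
    using edge_class_Hom[OF c[of 2]] edge_class_Hom[OF c[of 0]] t assms(2) d[of 2 1] d[of 2 0] d[of 0 0]
    by (intro ArrMap_Comp) auto
qed

lemma front_edge_facts:
  assumes "\<sigma> \<in> Simp X (Suc n)"
  shows "front_face X 1 n \<sigma> \<in> Simp X 1"
    "Face X 1 1 (front_face X 1 n \<sigma>) = first_vertex X (Suc n) \<sigma>"
    "Face X 1 0 (front_face X 1 n \<sigma>) = first_vertex X n (Face X (Suc n) 0 \<sigma>)"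
    "edge_class X (front_face X 1 n \<sigma>) \<in>
      Hom G (first_vertex X (Suc n) \<sigma>) (first_vertex X n (Face X (Suc n) 0 \<sigma>))"
proof -
  show a: "front_face X 1 n \<sigma> \<in> Simp X 1" using front_face_closed[of \<sigma> 1 n] assms by simp
  show b: "Face X 1 1 (front_face X 1 n \<sigma>) = first_vertex X (Suc n) \<sigma>"
    using last_Face_front_face[of 0 n \<sigma>] by simp
  show c: "Face X 1 0 (front_face X 1 n \<sigma>) = first_vertex X n (Face X (Suc n) 0 \<sigma>)"
    using Face_front_face[of \<sigma> 0 n 0] assms by simp
  show "edge_class X (front_face X 1 n \<sigma>) \<in>
      Hom G (first_vertex X (Suc n) \<sigma>) (first_vertex X n (Face X (Suc n) 0 \<sigma>))"
    using edge_class_Hom[OF a] unfolding b c .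
qed

lemma first_vertex_closed: "\<sigma> \<in> Simp X n \<Longrightarrow> first_vertex X n \<sigma> \<in> Simp X 0"
  using front_face_closed[of \<sigma> 0 n] by simp

lemma first_vertex_Face:
  "\<lbrakk>\<sigma> \<in> Simp X (Suc n); 0 < i; i \<le> Suc n\<rbrakk> \<Longrightarrow> first_vertex X n (Face X (Suc n) i \<sigma>) = first_vertex X (Suc n) \<sigma>"
  using front_face_Face[of \<sigma> 0 n i] by simp

lemma face_transport_hom:
  assumes "\<sigma> \<in> Simp X (Suc n)" "i \<le> Suc n"
  shows "abelian_group_hom (ObjMap A (first_vertex X n (Face X (Suc n) i \<sigma>)))
    (ObjMap A (first_vertex X (Suc n) \<sigma>)) (face_transport X A n \<sigma> i)"
proof (cases "i = 0")
  case True
  have "face_transport X A n \<sigma> i = ArrMap A (Inv G (edge_class X (front_face X 1 n \<sigma>)))"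
    by (simp add: face_transport_def fun_eq_iff True)
  moreover have "abelian_group_hom (ObjMap A (first_vertex X n (Face X (Suc n) 0 \<sigma>)))
      (ObjMap A (first_vertex X (Suc n) \<sigma>)) (ArrMap A (Inv G (edge_class X (front_face X 1 n \<sigma>))))"
    using first_vertex_closed[OF assms(1)] first_vertex_closed[OF Face_closed[OF assms(1), of 0]]
    by (intro ArrMap_group_hom Inv_closed front_edge_facts(4)[OF assms(1)]) simp_all
  ultimately show ?thesis unfolding True by simp
next
  case False
  have "face_transport X A n \<sigma> i = (\<lambda>a. a)" by (simp add: face_transport_def fun_eq_iff False)
  then show ?thesis
    using first_vertex_Face[OF assms(1), of i] False assms(2) coefficient_group[OF first_vertex_closed[OF assms(1)]]
    by (auto intro!: abelian_group_homI simp: group_hom_def group_hom_axioms_def hom_def abelian_group.a_group)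
qed

lemma seminorm_face_transport_le:
  assumes "\<sigma> \<in> Simp X (Suc n)" "i \<le> Suc n" "a \<in> carrier (ObjMap A (first_vertex X n (Face X (Suc n) i \<sigma>)))"
  shows "seminorm (ObjMap A (first_vertex X (Suc n) \<sigma>)) (face_transport X A n \<sigma> i a) \<le>
    seminorm (ObjMap A (first_vertex X n (Face X (Suc n) i \<sigma>))) a"
proof (cases "i = 0")
  case True
  have "seminorm (ObjMap A (first_vertex X (Suc n) \<sigma>)) (ArrMap A (Inv G (edge_class X (front_face X 1 n \<sigma>))) a) \<le>
      seminorm (ObjMap A (first_vertex X n (Face X (Suc n) 0 \<sigma>))) a"
    using first_vertex_closed[OF assms(1)] first_vertex_closed[OF Face_closed[OF assms(1), of 0]] assms(3) True
    by (intro seminorm_ArrMap_le Inv_closed front_edge_facts(4)[OF assms(1)]) simp_all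
  then show ?thesis using True by (simp add: face_transport_def)
qed (use first_vertex_Face[OF assms(1)] assms in \<open>simp add: face_transport_def\<close>)

lemma face_transport_closed:
  assumes "\<sigma> \<in> Simp X (Suc n)" "i \<le> Suc n" "a \<in> carrier (ObjMap A (first_vertex X n (Face X (Suc n) i \<sigma>)))"
  shows "face_transport X A n \<sigma> i a \<in> carrier (ObjMap A (first_vertex X (Suc n) \<sigma>))"
  using abelian_group_hom.hom_closed[OF face_transport_hom[OF assms(1,2)] assms(3)] .

text \<open>This is the simplicial identity for faces with coefficients. For i > 0 no transport
  occurs; for i = 0 and j > 1 both sides transport along the same front edge; for i = 0 and j = 1
  the claim is functoriality on the front triangle.\<close>

lemma face_transport_comp:
  assumes \<sigma>: "\<sigma> \<in> Simp X (Suc (Suc n))" and ij: "i < j" "j \<le> Suc (Suc n)"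
    and a: "a \<in> carrier (ObjMap A (first_vertex X n (Face X (Suc n) i (Face X (Suc (Suc n)) j \<sigma>))))"
  shows "face_transport X A (Suc n) \<sigma> j (face_transport X A n (Face X (Suc (Suc n)) j \<sigma>) i a) =
    face_transport X A (Suc n) \<sigma> i (face_transport X A n (Face X (Suc (Suc n)) i \<sigma>) (j - 1) a)"
proof -
  consider "0 < i" | "i = 0" "1 < j" | "i = 0" "j = 1" using ij by linarith
  then show ?thesis
  proof cases
    case 1
    then show ?thesis using ij by (simp add: face_transport_def)
  next
    case 2
    have "front_face X (Suc 0) n (Face X (Suc (Suc n)) j \<sigma>) = front_face X (Suc 0) (Suc n) \<sigma>"
      using front_face_Face[of \<sigma> 1 n j] \<sigma> ij 2 by simp
    then show ?thesis using 2 by (simp add: face_transport_def)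
  next
    case 3
    \<comment> \<open>The three edges of the front triangle are the front edges of \<sigma>, of d_0
      \<sigma> and of d_1 \<sigma>.\<close>
    let ?T = "front_face X 2 n \<sigma>"
    let ?d0 = "Face X (Suc (Suc n)) 0 \<sigma>" and ?d1 = "Face X (Suc (Suc n)) 1 \<sigma>"
    have T: "?T \<in> Simp X 2" using front_face_closed[of \<sigma> 2 n] \<sigma> by simp
    have F: "Face X 2 2 ?T = front_face X 1 (Suc n) \<sigma>" "Face X 2 0 ?T = front_face X 1 n ?d0"
      "Face X 2 1 ?T = front_face X 1 n ?d1"
      using last_Face_front_face[of 1 n \<sigma>] Face_front_face[of \<sigma> 1 n 0] Face_front_face[of \<sigma> 1 n 1] \<sigma>
      by (simp_all add: numeral_2_eq_2)
    have d: "?d0 \<in> Simp X (Suc n)" "?d1 \<in> Simp X (Suc n)" using Face_closed[OF \<sigma>] by auto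
    note f0 = front_edge_facts[OF \<sigma>] and f1 = front_edge_facts[OF d(1)] and f2 = front_edge_facts[OF d(2)]
    let ?u = "first_vertex X (Suc (Suc n)) \<sigma>" and ?v = "first_vertex X (Suc n) ?d0"
    let ?w = "first_vertex X n (Face X (Suc n) 0 ?d0)"
    have w: "first_vertex X n (Face X (Suc n) 0 ?d1) = ?w" using Face_Face[OF \<sigma>, of 0 1] by simp
    have u: "first_vertex X (Suc n) ?d1 = ?u" using first_vertex_Face[OF \<sigma>, of 1] by simp
    have o: "?u \<in> Simp X 0" "?v \<in> Simp X 0" "?w \<in> Simp X 0"
      using first_vertex_closed \<sigma> d Face_closed[OF d(1), of 0] by auto
    define f g h where fgh: "f = edge_class X (front_face X 1 (Suc n) \<sigma>)" "g = edge_class X (front_face X 1 n ?d0)"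
      "h = edge_class X (front_face X 1 n ?d1)"
    have Hom: "f \<in> Hom G ?u ?v" "g \<in> Hom G ?v ?w" "h \<in> Hom G ?u ?w"
      using f0(4) f1(4) f2(4) unfolding fgh u w .
    define b where "b = ArrMap A (Inv G f) (ArrMap A (Inv G g) a)"
    have aw: "a \<in> carrier (ObjMap A ?w)" using a w 3 by simp
    have gv: "ArrMap A (Inv G g) a \<in> carrier (ObjMap A ?v)"
      by (rule ArrMap_closed[OF o(3,2) Inv_closed aw]) (use o Hom in simp_all)
    then have b: "b \<in> carrier (ObjMap A ?u)"
      unfolding b_def by (intro ArrMap_closed[OF o(2,1) Inv_closed]) (use o Hom in simp_all)
    \<comment> \<open>To identify \<open>b\<close> with the inverse transport of \<open>a\<close>
      along \<open>h\<close>, it is enough that \<open>h\<close> sends \<open>b\<close> to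
      \<open>a\<close>.\<close>
    have "ArrMap A h b = ArrMap A g (ArrMap A f b)"
      using ArrMap_triangle[OF T, of b] b f0(2) unfolding F fgh by simp
    also have "\<dots> = a"
      unfolding b_def ArrMap_Inv_right[OF o(1,2) Hom(1) gv] by (rule ArrMap_Inv_right[OF o(2,3) Hom(2) aw])
    finally have "ArrMap A (Inv G h) a = b" using ArrMap_Inv_left[OF o(1,3) Hom(3) b] by simp
    then show ?thesis using 3 by (simp add: face_transport_def b_def fgh)
  qed
qed

lemma cochain_closed:
  "\<lbrakk>\<phi> \<in> carrier (C n); \<sigma> \<in> Simp X n\<rbrakk> \<Longrightarrow> \<phi> \<sigma> \<in> carrier (ObjMap A (first_vertex X n \<sigma>))"
  using bounded_sections_closed[of \<phi> "Simp X n" "\<lambda>\<sigma>. ObjMap A (first_vertex X n \<sigma>)" \<sigma>]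
  by (simp add: bounded_cochains_def)

text \<open>Absorbing the transport into \<open>face_transport\<close> turns the differential into
  one alternating sum in which face 0 needs no separate treatment.\<close>

lemma bounded_coboundary_eq:
  assumes \<phi>: "\<phi> \<in> carrier (C n)" and \<sigma>: "\<sigma> \<in> Simp X (Suc n)"
  shows "\<delta> n \<phi> \<sigma> = finsum (ObjMap A (first_vertex X (Suc n) \<sigma>))
    (\<lambda>i. signed (ObjMap A (first_vertex X (Suc n) \<sigma>)) i (face_transport X A n \<sigma> i (\<phi> (Face X (Suc n) i \<sigma>)))) {..Suc n}"
proof -
  let ?M = "ObjMap A (first_vertex X (Suc n) \<sigma>)"
  interpret M: abelian_group ?M by (rule coefficient_group[OF first_vertex_closed[OF \<sigma>]])
  have t: "face_transport X A n \<sigma> i (\<phi> (Face X (Suc n) i \<sigma>)) \<in> carrier ?M" if "i \<le> Suc n" for i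
    using that by (intro face_transport_closed[OF \<sigma>] cochain_closed[OF \<phi>] Face_closed[OF \<sigma>])
  have "finsum ?M (\<lambda>i. [((-1::int) ^ i)] \<cdot>\<^bsub>?M\<^esub> \<phi> (Face X (Suc n) i \<sigma>)) {1..Suc n} =
      finsum ?M (\<lambda>i. signed ?M i (face_transport X A n \<sigma> i (\<phi> (Face X (Suc n) i \<sigma>)))) {1..Suc n}"
  proof (rule M.add.finprod_cong')
    fix i assume i: "i \<in> {1..Suc n}"
    then show "[((-1::int) ^ i)] \<cdot>\<^bsub>?M\<^esub> \<phi> (Face X (Suc n) i \<sigma>) =
        signed ?M i (face_transport X A n \<sigma> i (\<phi> (Face X (Suc n) i \<sigma>)))"
      using t[of i] by (subst M.add_pow_minus_one_power) (auto simp: face_transport_def)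
  qed (use t in auto)
  moreover have "{..Suc n} = insert 0 {1..Suc n}" by auto
  moreover have "finsum ?M (\<lambda>i. signed ?M i (face_transport X A n \<sigma> i (\<phi> (Face X (Suc n) i \<sigma>)))) (insert 0 {1..Suc n}) =
      ArrMap A (Inv G (edge_class X (front_edge X (Suc n) \<sigma>))) (\<phi> (Face X (Suc n) 0 \<sigma>)) \<oplus>\<^bsub>?M\<^esub>
      finsum ?M (\<lambda>i. signed ?M i (face_transport X A n \<sigma> i (\<phi> (Face X (Suc n) i \<sigma>)))) {1..Suc n}"
    using t[of 0] t by (subst M.add.finprod_insert) (auto simp: signed_def face_transport_def[of _ _ _ _ 0])
  ultimately show ?thesis using \<sigma> by (simp add: bounded_coboundary_def Let_def)
qed

lemma abelian_group_cochains: "abelian_group (C n)"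
  unfolding bounded_cochains_def
  by (rule abelian_group_bounded_sections[where R = R]) (auto intro!: ObjMap_module first_vertex_closed)

lemma coboundary_closed:
  assumes \<phi>: "\<phi> \<in> carrier (C n)" shows "\<delta> n \<phi> \<in> carrier (C (Suc n))"
proof -
  \<comment> \<open>\<open>?c\<close> accounts for the signs. As transport does not increase
    seminorms, the n + 2 summands have a common bound independent of the simplex.\<close>
  let ?c = "max 1 (rnorm R (\<ominus>\<^bsub>R\<^esub> \<one>\<^bsub>R\<^esub>))"
  let ?t = "\<lambda>\<sigma> i. signed (ObjMap A (first_vertex X (Suc n) \<sigma>)) i (face_transport X A n \<sigma> i (\<phi> (Face X (Suc n) i \<sigma>)))"
  have f: "\<phi> (Face X (Suc n) i \<sigma>) \<in> carrier (ObjMap A (first_vertex X n (Face X (Suc n) i \<sigma>)))"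
    if "\<sigma> \<in> Simp X (Suc n)" "i \<le> Suc n" for \<sigma> i
    using that by (intro cochain_closed[OF \<phi>] Face_closed)
  have t: "face_transport X A n \<sigma> i (\<phi> (Face X (Suc n) i \<sigma>)) \<in> carrier (ObjMap A (first_vertex X (Suc n) \<sigma>))"
    if "\<sigma> \<in> Simp X (Suc n)" "i \<le> Suc n" for \<sigma> i
    using that f by (intro face_transport_closed)
  have closed: "\<delta> n \<phi> \<sigma> \<in> carrier (ObjMap A (first_vertex X (Suc n) \<sigma>))" if \<sigma>: "\<sigma> \<in> Simp X (Suc n)" for \<sigma>
  proof -
    interpret M: abelian_group "ObjMap A (first_vertex X (Suc n) \<sigma>)"
      by (rule coefficient_group[OF first_vertex_closed[OF \<sigma>]])
    show ?thesis unfolding bounded_coboundary_eq[OF \<phi> \<sigma>]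
      using t[OF \<sigma>] by (intro M.finsum_closed) auto
  qed
  show ?thesis
    unfolding bounded_cochains_def
  proof (rule bounded_sectionsI)
    show "\<delta> n \<phi> \<in> (\<Pi>\<^sub>E \<sigma>\<in>Simp X (Suc n). carrier (ObjMap A (first_vertex X (Suc n) \<sigma>)))"
      using closed by (auto simp: bounded_coboundary_def PiE_iff)
    fix \<sigma> assume \<sigma>: "\<sigma> \<in> Simp X (Suc n)"
    let ?M = "ObjMap A (first_vertex X (Suc n) \<sigma>)"
    interpret M: seminormed_module R ?M using ObjMap_module first_vertex_closed[OF \<sigma>] by simp
    have le: "0 \<le> seminorm ?M (?t \<sigma> i)" "seminorm ?M (?t \<sigma> i) \<le> ?c * seminorm (C n) \<phi>" if i: "i \<le> Suc n" for i
    proof -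
      show "0 \<le> seminorm ?M (?t \<sigma> i)" using M.seminorm_nonneg t[OF \<sigma> i] M.signed_closed by blast
      have "seminorm ?M (?t \<sigma> i) \<le> ?c * seminorm ?M (face_transport X A n \<sigma> i (\<phi> (Face X (Suc n) i \<sigma>)))"
        by (rule M.seminorm_signed_le[OF t[OF \<sigma> i]])
      also have "\<dots> \<le> ?c * seminorm (C n) \<phi>"
        using seminorm_face_transport_le[OF \<sigma> i f[OF \<sigma> i]] Face_closed[OF \<sigma> i]
          seminorm_le_bounded_sections[of \<phi> "Simp X n" "\<lambda>\<sigma>. ObjMap A (first_vertex X n \<sigma>)"] \<phi>
        by (intro mult_left_mono) (force simp: bounded_cochains_def)+
      finally show "seminorm ?M (?t \<sigma> i) \<le> ?c * seminorm (C n) \<phi>" .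
    qed
    have "seminorm ?M (\<delta> n \<phi> \<sigma>) \<le> rnorm R \<one>\<^bsub>R\<^esub> * (\<Sum>i\<le>Suc n. seminorm ?M (?t \<sigma> i))"
      unfolding bounded_coboundary_eq[OF \<phi> \<sigma>]
      using t[OF \<sigma>] by (intro M.seminorm_finsum_le) auto
    also have "\<dots> \<le> \<bar>rnorm R \<one>\<^bsub>R\<^esub>\<bar> * (\<Sum>i\<le>Suc n. ?c * seminorm (C n) \<phi>)"
      using le by (intro mult_mono sum_mono sum_nonneg) auto
    finally show "seminorm ?M (\<delta> n \<phi> \<sigma>) \<le> \<bar>rnorm R \<one>\<^bsub>R\<^esub>\<bar> * (\<Sum>i\<le>Suc n. ?c * seminorm (C n) \<phi>)" .
  qed
qed

lemma coboundary_hom: "abelian_group_hom (C n) (C (Suc n)) (\<delta> n)"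
proof (intro abelian_group_homI abelian_group_cochains)
  have "\<delta> n (\<phi> \<oplus>\<^bsub>C n\<^esub> \<psi>) = \<delta> n \<phi> \<oplus>\<^bsub>C (Suc n)\<^esub> \<delta> n \<psi>" if \<phi>: "\<phi> \<in> carrier (C n)" and \<psi>: "\<psi> \<in> carrier (C n)" for \<phi> \<psi>
  proof -
    note sum = abelian_groupE(1)[OF abelian_group_cochains]
    show ?thesis
    proof (rule bounded_sections_eqI)
      show "\<delta> n (\<phi> \<oplus>\<^bsub>C n\<^esub> \<psi>) \<in> carrier (bounded_sections (Simp X (Suc n)) (\<lambda>\<sigma>. ObjMap A (first_vertex X (Suc n) \<sigma>)))"
        using coboundary_closed[OF sum[OF \<phi> \<psi>]] by (simp add: bounded_cochains_def)
      show "\<delta> n \<phi> \<oplus>\<^bsub>C (Suc n)\<^esub> \<delta> n \<psi> \<in> carrier (bounded_sections (Simp X (Suc n)) (\<lambda>\<sigma>. ObjMap A (first_vertex X (Suc n) \<sigma>)))"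
        using sum[OF coboundary_closed[OF \<phi>] coboundary_closed[OF \<psi>]] by (simp add: bounded_cochains_def)
      fix \<sigma> assume \<sigma>: "\<sigma> \<in> Simp X (Suc n)"
      let ?M = "ObjMap A (first_vertex X (Suc n) \<sigma>)"
      interpret M: abelian_group ?M by (rule coefficient_group[OF first_vertex_closed[OF \<sigma>]])
      let ?t = "\<lambda>\<phi> i. signed ?M i (face_transport X A n \<sigma> i (\<phi> (Face X (Suc n) i \<sigma>)))"
      have t: "?t \<phi> i \<in> carrier ?M" if "\<phi> \<in> carrier (C n)" "i \<le> Suc n" for \<phi> i
        using that by (intro M.signed_closed face_transport_closed[OF \<sigma>] cochain_closed Face_closed[OF \<sigma>])
      have "?t (\<phi> \<oplus>\<^bsub>C n\<^esub> \<psi>) i = ?t \<phi> i \<oplus>\<^bsub>?M\<^esub> ?t \<psi> i" if i: "i \<le> Suc n" for i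
      proof -
        let ?d = "Face X (Suc n) i \<sigma>"
        have d: "?d \<in> Simp X n" by (rule Face_closed[OF \<sigma> i])
        have "(\<phi> \<oplus>\<^bsub>C n\<^esub> \<psi>) ?d = \<phi> ?d \<oplus>\<^bsub>ObjMap A (first_vertex X n ?d)\<^esub> \<psi> ?d"
          using d by (simp add: bounded_cochains_def bounded_sections_simps(3))
        then show ?thesis
          using abelian_group_hom.hom_add[OF face_transport_hom[OF \<sigma> i], of "\<phi> ?d" "\<psi> ?d"]
            abelian_group_hom.hom_add[OF M.signed_hom]
            cochain_closed[OF \<phi> d] cochain_closed[OF \<psi> d] face_transport_closed[OF \<sigma> i]
          by simp
      qed
      then have "finsum ?M (?t (\<phi> \<oplus>\<^bsub>C n\<^esub> \<psi>)) {..Suc n} = finsum ?M (\<lambda>i. ?t \<phi> i \<oplus>\<^bsub>?M\<^esub> ?t \<psi> i) {..Suc n}"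
        using t \<phi> \<psi> by (intro M.add.finprod_cong') auto
      also have "\<dots> = finsum ?M (?t \<phi>) {..Suc n} \<oplus>\<^bsub>?M\<^esub> finsum ?M (?t \<psi>) {..Suc n}"
        using t \<phi> \<psi> by (intro M.add.finprod_multf) auto
      finally show "\<delta> n (\<phi> \<oplus>\<^bsub>C n\<^esub> \<psi>) \<sigma> = (\<delta> n \<phi> \<oplus>\<^bsub>C (Suc n)\<^esub> \<delta> n \<psi>) \<sigma>"
        using \<sigma> bounded_coboundary_eq[OF _ \<sigma>] \<phi> \<psi> sum[OF \<phi> \<psi>]
        by (simp add: bounded_cochains_def bounded_sections_simps(3))
    qed
  qed
  then show "group_hom (add_monoid (C n)) (add_monoid (C (Suc n))) (\<delta> n)"
    using coboundary_closed
    by (auto simp: group_hom_def group_hom_axioms_def hom_def abelian_group.a_group abelian_group_cochains)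
qed

text \<open>Transport is additive and so passes into the inner sum. The resulting double sum is of
  the cancelling kind, with the required symmetry supplied by
  \<open>face_transport_comp\<close>.\<close>

lemma coboundary_coboundary:
  assumes \<phi>: "\<phi> \<in> carrier (C n)" shows "\<delta> (Suc n) (\<delta> n \<phi>) = \<zero>\<^bsub>C (Suc (Suc n))\<^esub>"
proof (rule bounded_sections_eqI)
  show "\<delta> (Suc n) (\<delta> n \<phi>) \<in>
      carrier (bounded_sections (Simp X (Suc (Suc n))) (\<lambda>\<sigma>. ObjMap A (first_vertex X (Suc (Suc n)) \<sigma>)))"
    using coboundary_closed[OF coboundary_closed[OF \<phi>]] by (simp add: bounded_cochains_def)
  show "\<zero>\<^bsub>C (Suc (Suc n))\<^esub> \<in>
      carrier (bounded_sections (Simp X (Suc (Suc n))) (\<lambda>\<sigma>. ObjMap A (first_vertex X (Suc (Suc n)) \<sigma>)))"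
    using abelian_groupE(2)[OF abelian_group_cochains[of "Suc (Suc n)"]] by (simp add: bounded_cochains_def)
  fix \<sigma> assume \<sigma>: "\<sigma> \<in> Simp X (Suc (Suc n))"
  let ?M = "ObjMap A (first_vertex X (Suc (Suc n)) \<sigma>)" and ?d = "\<lambda>i. Face X (Suc (Suc n)) i \<sigma>"
  interpret M: abelian_group ?M by (rule coefficient_group[OF first_vertex_closed[OF \<sigma>]])
  define g where "g i j = face_transport X A (Suc n) \<sigma> i
    (face_transport X A n (?d i) j (\<phi> (Face X (Suc n) j (?d i))))" for i j
  have dd: "\<phi> (Face X (Suc n) j (?d i)) \<in> carrier (ObjMap A (first_vertex X n (Face X (Suc n) j (?d i))))"
    if "i \<le> Suc (Suc n)" "j \<le> Suc n" for i j
    using that \<sigma> by (intro cochain_closed[OF \<phi>] Face_closed)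
  have t: "face_transport X A n (?d i) j (\<phi> (Face X (Suc n) j (?d i))) \<in> carrier (ObjMap A (first_vertex X (Suc n) (?d i)))"
    if "i \<le> Suc (Suc n)" "j \<le> Suc n" for i j
    using that dd by (intro face_transport_closed Face_closed[OF \<sigma>])
  have g: "g i j \<in> carrier ?M" if "i \<le> Suc (Suc n)" "j \<le> Suc n" for i j
    unfolding g_def using that t by (intro face_transport_closed[OF \<sigma>])
  have inner: "face_transport X A (Suc n) \<sigma> i (\<delta> n \<phi> (?d i)) = finsum ?M (\<lambda>j. signed ?M j (g i j)) {..Suc n}"
    if i: "i \<le> Suc (Suc n)" for i
  proof -
    let ?N = "ObjMap A (first_vertex X (Suc n) (?d i))"
    have di: "?d i \<in> Simp X (Suc n)" by (rule Face_closed[OF \<sigma> i])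
    interpret h: abelian_group_hom ?N ?M "face_transport X A (Suc n) \<sigma> i" by (rule face_transport_hom[OF \<sigma> i])
    have "face_transport X A (Suc n) \<sigma> i (\<delta> n \<phi> (?d i)) =
       finsum ?M (\<lambda>j. face_transport X A (Suc n) \<sigma> i
        (signed ?N j (face_transport X A n (?d i) j (\<phi> (Face X (Suc n) j (?d i)))))) {..Suc n}"
      unfolding bounded_coboundary_eq[OF \<phi> di]
      using t[OF i] by (intro abelian_group_hom_finsum[OF h.is_abelian_group_hom]) auto
    also have "\<dots> = finsum ?M (\<lambda>j. signed ?M j (g i j)) {..Suc n}"
      using t[OF i] g[OF i] by (intro M.add.finprod_cong') (auto simp: signed_def g_def)
    finally show ?thesis .
  qed
  have "\<delta> (Suc n) (\<delta> n \<phi>) \<sigma> =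
      finsum ?M (\<lambda>i. signed ?M i (face_transport X A (Suc n) \<sigma> i (\<delta> n \<phi> (?d i)))) {..Suc (Suc n)}"
    by (rule bounded_coboundary_eq[OF coboundary_closed[OF \<phi>] \<sigma>])
  also have "\<dots> = finsum ?M (\<lambda>i. signed ?M i (finsum ?M (\<lambda>j. signed ?M j (g i j)) {..Suc n})) {..Suc (Suc n)}"
    using inner g by (intro M.add.finprod_cong') (auto intro!: M.signed_closed M.finsum_closed)
  also have "\<dots> = \<zero>\<^bsub>?M\<^esub>"
  proof (rule M.alternating_double_sum_zero[OF g])
    fix i j :: nat assume ij: "i < j" "j \<le> Suc (Suc n)"
    then show "g j i = g i (j - 1)"
      using face_transport_comp[OF \<sigma> ij] dd[of j i] Face_Face[OF \<sigma> ij] by (simp add: g_def)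
  qed
  finally show "\<delta> (Suc n) (\<delta> n \<phi>) \<sigma> = \<zero>\<^bsub>C (Suc (Suc n))\<^esub> \<sigma>"
    using \<sigma> by (simp add: bounded_cochains_def bounded_sections_simps(2))
qed

end

section \<open>The contracting homotopy on cochains\<close>

text \<open>A cone has first vertex \<open>x\<close>, so the cochain takes its value there in the
  module at \<open>x\<close>. The edge from \<open>x\<close> to the first vertex of \<sigma> carries
  it to the right module.\<close>

definition contraction :: "'x sset \<Rightarrow> ('x, 'r, 'm) local_system \<Rightarrow> 'x \<Rightarrow> nat \<Rightarrow> ('x \<Rightarrow> 'm) \<Rightarrow> 'x \<Rightarrow> 'm" where
  "contraction X A x m \<phi> = (\<lambda>\<sigma>\<in>Simp X m.
     ArrMap A (edge_class X (cone X x 0 (first_vertex X m \<sigma>))) (\<phi> (cone X x m \<sigma>)))"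

locale connected_coefficients = connected_Kan_complex X n x + local_coefficients R X A
  for R :: "'r normed_ring" and X :: "'x sset" and A :: "('x, 'r, 'm) local_system" and n x
begin

lemma cone_edge:
  assumes "v \<in> Simp X 0"
  shows "edge_class X (cone X x 0 v) \<in> Hom G x v"
  using edge_class_Hom[of "cone X x 0 v"] cone_zero[OF assms] by simp

lemma cochain_cone_closed:
  assumes "m \<le> n" "\<phi> \<in> carrier (C (Suc m))" "\<sigma> \<in> Simp X m"
  shows "\<phi> (cone X x m \<sigma>) \<in> carrier (ObjMap A x)"
  using cochain_closed[OF assms(2) cone_closed[OF assms(1,3)]] first_vertex_cone[OF assms(1,3)] by simp

text \<open>The values on cones are among all values of \<phi>, and transport does not increase
  seminorms. This gives the constant 1.\<close>

lemma contraction_closed: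
  assumes "m \<le> n" "\<phi> \<in> carrier (C (Suc m))"
  shows "contraction X A x m \<phi> \<in> carrier (C m)"
    and "seminorm (C m) (contraction X A x m \<phi>) \<le> seminorm (C (Suc m)) \<phi>"
proof -
  have \<phi>: "\<phi> \<in> carrier (bounded_sections (Simp X (Suc m)) (\<lambda>\<sigma>. ObjMap A (first_vertex X (Suc m) \<sigma>)))"
    using assms(2) by (simp add: bounded_cochains_def)
  have le: "seminorm (ObjMap A (first_vertex X m \<sigma>)) (contraction X A x m \<phi> \<sigma>) \<le> seminorm (C (Suc m)) \<phi>"
    if \<sigma>: "\<sigma> \<in> Simp X m" for \<sigma>
  proof -
    have "seminorm (ObjMap A (first_vertex X m \<sigma>)) (contraction X A x m \<phi> \<sigma>) \<le>
        seminorm (ObjMap A x) (\<phi> (cone X x m \<sigma>))"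
      using seminorm_ArrMap_le[OF base first_vertex_closed[OF \<sigma>] cone_edge[OF first_vertex_closed[OF \<sigma>]]
          cochain_cone_closed[OF assms \<sigma>]] \<sigma> by (simp add: contraction_def)
    also have "\<dots> \<le> seminorm (C (Suc m)) \<phi>"
      using seminorm_le_bounded_sections[OF \<phi> cone_closed[OF assms(1) \<sigma>]] first_vertex_cone[OF assms(1) \<sigma>]
      by (simp add: bounded_cochains_def)
    finally show ?thesis .
  qed
  show "contraction X A x m \<phi> \<in> carrier (C m)"
    unfolding bounded_cochains_def
  proof (rule bounded_sectionsI)
    show "contraction X A x m \<phi> \<in> (\<Pi>\<^sub>E \<sigma>\<in>Simp X m. carrier (ObjMap A (first_vertex X m \<sigma>)))"
      unfolding contraction_def
      by (auto intro!: ArrMap_closed[OF base] first_vertex_closed cone_edge cochain_cone_closed[OF assms])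
  qed (rule le)
  show "seminorm (C m) (contraction X A x m \<phi>) \<le> seminorm (C (Suc m)) \<phi>"
    unfolding bounded_cochains_def[of _ _ m]
    using bounded_sections_seminorm_nonneg[OF \<phi>] le
    by (intro bounded_sections_seminorm_le) (simp_all add: bounded_cochains_def)
qed

text \<open>Faces with i > 0 keep the first vertex, so nothing changes. For i = 0 the cone over the
  front edge of \<sigma> is a triangle, and functoriality on it compares the transports to the first
  two vertices of \<sigma>.\<close>

lemma face_transport_contraction:
  assumes m: "Suc m \<le> n" and \<phi>: "\<phi> \<in> carrier (C (Suc m))" and \<sigma>: "\<sigma> \<in> Simp X (Suc m)" and i: "i \<le> Suc m"
  shows "face_transport X A m \<sigma> i (contraction X A x m \<phi> (Face X (Suc m) i \<sigma>)) =
    ArrMap A (edge_class X (cone X x 0 (first_vertex X (Suc m) \<sigma>))) (\<phi> (cone X x m (Face X (Suc m) i \<sigma>)))"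
proof -
  let ?d = "Face X (Suc m) i \<sigma>"
  have d: "?d \<in> Simp X m" by (rule Face_closed[OF \<sigma> i])
  show ?thesis
  proof (cases "i = 0")
    case False
    then show ?thesis
      using d first_vertex_Face[OF \<sigma>, of i] i by (simp add: face_transport_def contraction_def)
  next
    case True
    let ?d0 = "Face X (Suc m) 0 \<sigma>"
    have d0: "?d0 \<in> Simp X m" by (rule Face_closed[OF \<sigma>]) simp
    let ?f = "front_face X 1 m \<sigma>" and ?u = "first_vertex X (Suc m) \<sigma>" and ?v = "first_vertex X m ?d0"
    let ?a = "\<phi> (cone X x m ?d0)"
    note f = front_edge_facts[OF \<sigma>]
    have f1: "?f \<in> Simp X (Suc 0)" using f(1) by simp
    have T: "cone X x 1 ?f \<in> Simp X 2"
      using cone_closed[of 1 ?f] m f1 by (simp add: numeral_2_eq_2)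
    have "Face X 2 0 (cone X x 1 ?f) = ?f" "Face X 2 1 (cone X x 1 ?f) = cone X x 0 (Face X 1 0 ?f)"
      "Face X 2 2 (cone X x 1 ?f) = cone X x 0 (Face X 1 1 ?f)"
      using Face_cone_zero[of 1 ?f] Face_cone_Suc[of 0 ?f 0] Face_cone_Suc[of 0 ?f 1] m f1
      by (simp_all add: numeral_2_eq_2)
    then have F: "Face X 2 0 (cone X x 1 ?f) = ?f" "Face X 2 1 (cone X x 1 ?f) = cone X x 0 ?v"
      "Face X 2 2 (cone X x 1 ?f) = cone X x 0 ?u"
      using f(2,3) by simp_all
    have u: "?u \<in> Simp X 0" and v: "?v \<in> Simp X 0" using first_vertex_closed[OF \<sigma>] first_vertex_closed[OF d0] .
    have a: "?a \<in> carrier (ObjMap A x)" using cochain_cone_closed[OF _ \<phi> d0] m by simp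
    have a': "?a \<in> carrier (ObjMap A (Face X 1 1 (Face X 2 2 (cone X x 1 ?f))))"
      using a cone_zero[OF u] unfolding F by simp
    have "ArrMap A (edge_class X (cone X x 0 ?v)) ?a =
        ArrMap A (edge_class X ?f) (ArrMap A (edge_class X (cone X x 0 ?u)) ?a)"
      using ArrMap_triangle[OF T a'] unfolding F .
    then have "ArrMap A (Inv G (edge_class X ?f)) (ArrMap A (edge_class X (cone X x 0 ?v)) ?a) =
        ArrMap A (edge_class X (cone X x 0 ?u)) ?a"
      using ArrMap_Inv_left[OF u v f(4) ArrMap_closed[OF base u cone_edge[OF u] a]] by simp
    then show ?thesis using True d0 by (simp add: face_transport_def contraction_def)
  qed
qed

text \<open>The cocycle condition is evaluated on the cone over \<sigma>. Face 0 contributes \<phi>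
  \<sigma> transported back to \<open>x\<close>; the other faces are cones over the faces of
  \<sigma> and, after transport to the first vertex of \<sigma>, contribute minus the coboundary of
  the contraction.\<close>

lemma coboundary_contraction:
  assumes m: "Suc m \<le> n" and \<phi>: "\<phi> \<in> carrier (C (Suc m))" and cocycle: "\<delta> (Suc m) \<phi> = \<zero>\<^bsub>C (Suc (Suc m))\<^esub>"
  shows "\<delta> m (contraction X A x m \<phi>) = \<phi>"
proof -
  have s: "contraction X A x m \<phi> \<in> carrier (C m)" using contraction_closed(1)[OF _ \<phi>] m by simp
  show ?thesis
  proof (rule bounded_sections_eqI)
    show "\<delta> m (contraction X A x m \<phi>) \<in> carrier (bounded_sections (Simp X (Suc m)) (\<lambda>\<sigma>. ObjMap A (first_vertex X (Suc m) \<sigma>)))"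
      using coboundary_closed[OF s] by (simp add: bounded_cochains_def)
    show "\<phi> \<in> carrier (bounded_sections (Simp X (Suc m)) (\<lambda>\<sigma>. ObjMap A (first_vertex X (Suc m) \<sigma>)))"
      using \<phi> by (simp add: bounded_cochains_def)
    fix \<sigma> assume \<sigma>: "\<sigma> \<in> Simp X (Suc m)"
    let ?u = "first_vertex X (Suc m) \<sigma>" and ?c = "cone X x (Suc m) \<sigma>"
    let ?M = "ObjMap A ?u" and ?N = "ObjMap A x"
    have u: "?u \<in> Simp X 0" by (rule first_vertex_closed[OF \<sigma>])
    let ?e = "edge_class X (cone X x 0 ?u)"
    have e: "?e \<in> Hom G x ?u" by (rule cone_edge[OF u])
    interpret h: abelian_group_hom ?N ?M "ArrMap A ?e" by (rule ArrMap_group_hom[OF base u e])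
    interpret neg: abelian_group_hom ?M ?M "signed ?M 1" by (rule h.H.signed_hom)
    let ?\<phi> = "\<lambda>i. \<phi> (cone X x m (Face X (Suc m) i \<sigma>))"
    have b: "?\<phi> i \<in> carrier ?N" if "i \<le> Suc m" for i
      using that m by (intro cochain_cone_closed[OF _ \<phi>] Face_closed[OF \<sigma>]) simp_all
    \<comment> \<open>By \<open>face_transport_contraction\<close> this is the coboundary of the
      contraction at \<sigma>, with every cone value transported along the same edge.\<close>
    define S where "S = finsum ?M (\<lambda>i. signed ?M i (ArrMap A ?e (?\<phi> i))) {..Suc m}"
    have S: "S \<in> carrier ?M" unfolding S_def using b by (intro h.H.finsum_closed) auto
    have \<phi>\<sigma>: "\<phi> \<sigma> \<in> carrier ?M" by (rule cochain_closed[OF \<phi> \<sigma>])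
    have c: "?c \<in> Simp X (Suc (Suc m))" by (rule cone_closed[OF m \<sigma>])
    have vx: "first_vertex X (Suc (Suc m)) ?c = x" by (rule first_vertex_cone[OF m \<sigma>])
    let ?t = "\<lambda>i. face_transport X A (Suc m) ?c i (\<phi> (Face X (Suc (Suc m)) i ?c))"
    have t0: "?t 0 = ArrMap A (Inv G ?e) (\<phi> \<sigma>)"
      using front_edge_cone[OF m \<sigma>] Face_cone_zero[OF m \<sigma>] by (simp add: face_transport_def)
    have tS: "?t (Suc i) = ?\<phi> i" if "i \<le> Suc m" for i
      using Face_cone_Suc[OF m \<sigma> that] by (simp add: face_transport_def)
    have i0: "ArrMap A (Inv G ?e) (\<phi> \<sigma>) \<in> carrier ?N"
      using \<phi>\<sigma> u base e by (intro ArrMap_closed[OF u base Inv_closed]) simp_all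
    have t: "?t i \<in> carrier ?N" if "i \<le> Suc (Suc m)" for i
      using that t0 tS b i0 by (cases i) auto
    have "\<zero>\<^bsub>?N\<^esub> = \<delta> (Suc m) \<phi> ?c"
      unfolding cocycle using c vx by (simp add: bounded_cochains_def bounded_sections_simps(2))
    also have "\<dots> = finsum ?N (\<lambda>i. signed ?N i (?t i)) {..Suc (Suc m)}"
      unfolding bounded_coboundary_eq[OF \<phi> c] vx ..
    \<comment> \<open>Splitting off face 0 shifts the remaining indices by one; the extra sign is
      what produces -S below.\<close>
    also have "\<dots> = finsum ?N (\<lambda>i. signed ?N (Suc i) (?t (Suc i))) {..Suc m} \<oplus>\<^bsub>?N\<^esub> signed ?N 0 (?t 0)"
      using t by (intro h.G.add.finprod_Suc2) auto
    also have "signed ?N 0 (?t 0) = ArrMap A (Inv G ?e) (\<phi> \<sigma>)" unfolding t0 by (simp add: signed_def)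
    also have "finsum ?N (\<lambda>i. signed ?N (Suc i) (?t (Suc i))) {..Suc m} =
        finsum ?N (\<lambda>i. signed ?N (Suc i) (?\<phi> i)) {..Suc m}"
      using tS b by (intro h.G.add.finprod_cong') auto
    finally have "ArrMap A ?e \<zero>\<^bsub>?N\<^esub> = ArrMap A ?e
       (finsum ?N (\<lambda>i. signed ?N (Suc i) (?\<phi> i)) {..Suc m} \<oplus>\<^bsub>?N\<^esub> ArrMap A (Inv G ?e) (\<phi> \<sigma>))" by simp
    also have "\<dots> = ArrMap A ?e (finsum ?N (\<lambda>i. signed ?N (Suc i) (?\<phi> i)) {..Suc m}) \<oplus>\<^bsub>?M\<^esub>
        ArrMap A ?e (ArrMap A (Inv G ?e) (\<phi> \<sigma>))"
      using b i0 by (intro h.hom_add h.G.finsum_closed) auto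
    also have "ArrMap A ?e (ArrMap A (Inv G ?e) (\<phi> \<sigma>)) = \<phi> \<sigma>" by (rule ArrMap_Inv_right[OF base u e \<phi>\<sigma>])
    also have "ArrMap A ?e (finsum ?N (\<lambda>i. signed ?N (Suc i) (?\<phi> i)) {..Suc m}) =
        finsum ?M (\<lambda>i. ArrMap A ?e (signed ?N (Suc i) (?\<phi> i))) {..Suc m}"
      using b by (intro abelian_group_hom_finsum[OF h.is_abelian_group_hom]) auto
    also have "\<dots> = finsum ?M (\<lambda>i. signed ?M 1 (signed ?M i (ArrMap A ?e (?\<phi> i)))) {..Suc m}"
      using b by (intro h.H.add.finprod_cong') (auto simp: signed_def)
    also have "\<dots> = signed ?M 1 S"
      unfolding S_def using b by (intro abelian_group_hom_finsum[OF neg.is_abelian_group_hom, symmetric]) auto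
    finally have "\<ominus>\<^bsub>?M\<^esub> S \<oplus>\<^bsub>?M\<^esub> \<phi> \<sigma> = \<zero>\<^bsub>?M\<^esub>" by (simp add: signed_def)
    then have "\<ominus>\<^bsub>?M\<^esub> (\<phi> \<sigma>) = \<ominus>\<^bsub>?M\<^esub> S" using S \<phi>\<sigma> by (intro h.H.minus_equality) auto
    then have "S = \<phi> \<sigma>" using S \<phi>\<sigma> h.H.minus_minus by metis
    moreover have "\<delta> m (contraction X A x m \<phi>) \<sigma> = S"
      unfolding S_def bounded_coboundary_eq[OF s \<sigma>]
      using face_transport_contraction[OF m \<phi> \<sigma>] b by (intro h.H.add.finprod_cong') auto
    ultimately show "\<delta> m (contraction X A x m \<phi>) \<sigma> = \<phi> \<sigma>" by simp
  qed
qed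

section \<open>Cohomology and the uniform boundary condition\<close>

lemma Term_complex: "Term (bounded_cochain_complex X A) (int m) = C m"
  by (simp add: bounded_cochain_complex_def bounded_cochains_int_def)

lemma Diff_complex: "Diff (bounded_cochain_complex X A) (int m) = \<delta> m"
  by (simp add: bounded_cochain_complex_def fun_eq_iff)

lemma cocycles_eq_coboundaries:
  assumes "Suc m \<le> n"
  shows "cocycles (bounded_cochain_complex X A) (int (Suc m)) = coboundaries (bounded_cochain_complex X A) (int (Suc m))"
    and "cocycles (bounded_cochain_complex X A) (int (Suc m)) = a_kernel (C (Suc m)) (C (Suc (Suc m))) (\<delta> (Suc m))"
proof -
  have i: "int (Suc m) - 1 = int m" "int (Suc m) + 1 = int (Suc (Suc m))" by simp_all
  show Z: "cocycles (bounded_cochain_complex X A) (int (Suc m)) = a_kernel (C (Suc m)) (C (Suc (Suc m))) (\<delta> (Suc m))"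
    unfolding cocycles_def i Term_complex Diff_complex ..
  have "a_kernel (C (Suc m)) (C (Suc (Suc m))) (\<delta> (Suc m)) = \<delta> m ` carrier (C m)"
    using coboundary_closed coboundary_coboundary coboundary_contraction[OF assms] contraction_closed(1)[of m] assms
    by (force simp: a_kernel_def kernel_def image_iff)
  then show "cocycles (bounded_cochain_complex X A) (int (Suc m)) = coboundaries (bounded_cochain_complex X A) (int (Suc m))"
    unfolding Z coboundaries_def i Term_complex Diff_complex .
qed

text \<open>Coboundaries equal cocycles in these degrees, so the cohomology is the kernel of the
  differential modulo itself.\<close>

lemma trivial_bounded_cohomology:
  assumes "Suc m \<le> n" shows "trivial_group (bounded_cohomology X A (int (Suc m)))"
  unfolding bounded_cohomology_def cohomology_def cocycles_eq_coboundaries(1)[OF assms, symmetric]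
    cocycles_eq_coboundaries(2)[OF assms] Term_complex
  by (rule trivial_A_Mod_a_kernel[OF coboundary_hom])

text \<open>A coboundary is a cocycle, so its contraction is a primitive of no larger seminorm, and
  \<kappa> = 1 works.\<close>

lemma uniform_boundary_condition_Suc:
  assumes "Suc m \<le> n" shows "uniform_boundary_condition (bounded_cochain_complex X A) (int (Suc m))"
proof -
  have i: "int (Suc m) - 1 = int m" by simp
  have "\<exists>c\<in>carrier (C m). \<delta> m c = b \<and> seminorm (C m) c \<le> 1 * seminorm (C (Suc m)) b"
    if "b \<in> \<delta> m ` carrier (C m)" for b
  proof -
    have b: "b \<in> carrier (C (Suc m))" "\<delta> (Suc m) b = \<zero>\<^bsub>C (Suc (Suc m))\<^esub>"
      using that coboundary_closed coboundary_coboundary by auto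
    show ?thesis
      using contraction_closed[OF _ b(1)] coboundary_contraction[OF assms b] assms
      by (intro bexI[of _ "contraction X A x m b"]) auto
  qed
  then show ?thesis
    unfolding uniform_boundary_condition_def coboundaries_def i Term_complex Diff_complex
    by (intro exI[of _ 1]) simp
qed

end

lemma (in local_coefficients) uniform_boundary_condition_nonpos:
  assumes "i \<le> 0" shows "uniform_boundary_condition (bounded_cochain_complex X A) i"
proof -
  let ?K = "bounded_cochain_complex X A"
  have Term: "Term ?K (i - 1) = bounded_sections {} (ObjMap A)"
    using assms by (simp add: bounded_cochain_complex_def bounded_cochains_int_def)
  have nonneg: "0 \<le> seminorm (Term ?K i) \<zero>\<^bsub>Term ?K i\<^esub>"
  proof (cases "i = 0")
    case True
    then show ?thesis
      using bounded_sections_seminorm_nonneg[OF abelian_groupE(2)[OF abelian_group_cochains[of 0, unfolded bounded_cochains_def]]]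
      by (simp add: bounded_cochain_complex_def bounded_cochains_int_def bounded_cochains_def)
  qed (use assms in \<open>simp add: bounded_cochain_complex_def bounded_cochains_int_def bounded_sections_simps\<close>)
  \<comment> \<open>Over the empty index set the only section is the extensional function with value
    \<open>undefined\<close>; its seminorm is the supremum of {0}. As the incoming differential is
    zero, it is a primitive with \<kappa> = 0.\<close>
  have "(\<lambda>i. undefined) \<in> carrier (Term ?K (i - 1))" "seminorm (Term ?K (i - 1)) (\<lambda>i. undefined) = 0"
    unfolding Term by (simp_all add: bounded_sections_simps PiE_def)
  moreover have "Diff ?K (i - 1) c = \<zero>\<^bsub>Term ?K i\<^esub>" for c
    using assms by (simp add: bounded_cochain_complex_def)
  ultimately show ?thesis
    unfolding uniform_boundary_condition_def coboundaries_def using nonneg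
    by (intro exI[of _ 0]) (auto intro!: bexI[of _ "\<lambda>i. undefined"])
qed

theorem corollary3p11:
  fixes R :: "'r normed_ring"
    and X :: "'x sset"
    and A :: "('x, 'r, 'm) local_system"
    and n :: nat
  assumes "normed_ring R"
    and "n \<ge> 1"
    and "Kan_complex X"
    and "n_connected n X"
    and "seminormed_local_system R X A"
  shows "(\<forall>i\<in>{1..int n}. trivial_group (bounded_cohomology X A i)) \<and>
         (\<forall>i\<le>int n. uniform_boundary_condition (bounded_cochain_complex X A) i)"
proof -
  obtain x where "x \<in> Simp X 0" using assms(4) by (auto simp: n_connected_def)
  interpret Kan_complex X by fact
  interpret seminormed_functor R "fundamental_groupoid X" A by fact
  interpret connected_coefficients R X A n x by unfold_locales fact+
  \<comment> \<open>Degrees are integers: the positive ones up to \<open>n\<close> are rewritten as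
    successors for the contraction, and the remaining ones are \<le> 0.\<close>
  have Suc: "\<exists>m. i = int (Suc m) \<and> Suc m \<le> n" if "1 \<le> i" "i \<le> int n" for i
    using that by (intro exI[of _ "nat i - 1"]) auto
  show ?thesis
    using Suc trivial_bounded_cohomology uniform_boundary_condition_Suc uniform_boundary_condition_nonpos
    by (metis atLeastAtMost_iff int_one_le_iff_zero_less linorder_not_le)
qed

end
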